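(* Let $T>0$ and $q\in[1,+\infty]$. The hyperbolic system (H) is $L^q$-approximately (respectively, $L^q$-exactly) controllable in time $T$ if and only if the same is true for the difference equation (D).
   Context: Hyperbolic system (H). Let $n,m\ge 1$ be integers, $\tilde n\in\{0,\dots,n\}$, $M$ a real $n\times n$ matrix, $B$ a real $n\times m$ matrix. Let $\Lambda(x)=\operatorname{diag}(\lambda_1(x),\dots,\lambda_n(x))$, $x\in[0,1]$, with $\lambda_i(x)>0>\lambda_j(x)$ for all $i\le\tilde n<j$ and $x\in[0,1]$, and $\lambda_i,\frac1{\lambda_i}\in L^\infty((0,1),\mathbb{R})$ for every $i$. Let $D(x)=\operatorname{diag}(d_1(x),\dots,d_n(x))$ with $d_i\in L^1((0,1),\mathbb{R})$. System (H) is $$\partial_tR(t,x)+\Lambda(x)\partial_xR(t,x)+D(x)R(t,x)=0,\quad t>0,\ x\in(0,1),$$ $$\begin{pmatrix} R^+(t,0) \\ R^-(t,1) \end{pmatrix}=M\begin{pmatrix} R^+(t,1) \\ R^-(t,0) \end{pmatrix}+Bu(t),\quad t\ge0,$$ where $R^+=(R_1,\dots,R_{\tilde n})^T$, $R^-=(R_{\tilde n+1},\dots,R_n)^T$, and $u$ is an $\mathbb{R}^m$-valued control. For $T>0$, $u:[0,T]\to\mathbb{R}^m$ and $\bar R:[0,1]\to\mathbb{R}^n$, a function $R:[0,T]\times[0,1]\to\mathbb{R}^n$ is a solution of (H) in $[0,T]$ with initial condition $\bar R$ and control $u$ if $R(0,x)=\bar R(x)$ for $x\in[0,1]$, the boundary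 condition holds for $t\in[0,T]$, and for all $i\in\{1,\dots,n\}$, $t\in[0,T]$, $x\in[0,1]$, $$R_i\Big(t+\int_x^{x+h}\frac{d\xi}{\lambda_i(\xi)},x+h\Big)=e^{-\int_x^{x+h}\frac{d_i(\xi)}{\lambda_i(\xi)}d\xi}R_i(t,x)$$ for every $h\in\mathbb{R}$ with $t+\int_x^{x+h}\frac{d\xi}{\lambda_i(\xi)}\in[0,T]$ and $x+h\in[0,1]$. For $L^q$ data, functions are identified when equal almost everywhere; in this sense, for $\bar R\in L^q$ and $u\in L^q$ there is a unique solution, and $R(t,\cdot)\in L^q((0,1),\mathbb{R}^n)$ for all $t\in[0,T]$. (H) is $L^q$-approximately controllable in time $T$ if for every $\epsilon>0$ and $\phi,\psi\in L^q([0,1],\mathbb{R}^n)$ there is $u\in L^q([0,T],\mathbb{R}^m)$ such that the solution $R$ of (H) with initial condition $\phi$ and control $u$ satisfies $\|R(T,\cdot)-\psi\|_{L^q([0,1])}<\epsilon$; it is $L^q$-exactly controllable in time $T$ if for every such $\phi,\psi$ there is $u\in L^q([0,T],\mathbb{R}^m)$ such that $R(T,\cdot)=\psi$. Difference equation (D). Set $\tau_i=\int_0^1\frac{dx}{|\lambda_i(x)|}$ and $K=M\operatorname{diag}\big(e^{-\int_0^1\frac{d_1(x)}{|\lambda_1(x)|}dx},\dots,e^{-\int_0^1\frac{d_n(x)}{|\lambda_n(x)|}dx}\big)$. Equation (D) is $$\begin{pmatrix} y_1(t) \\ \vdots \\ y_n(t) \end{pmatrix}=K\begin{pmatrix} y_1(t-\tau_1)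 \\ \vdots \\ y_n(t-\tau_n) \end{pmatrix}+Bu(t),\qquad t\ge0.$$ A family $y_i:[-\tau_i,T]\to\mathbb{R}$, $i\in\{1,\dots,n\}$, is a solution of (D) in $[0,T]$ with control $u$ if the equation holds for every $t\in[0,T]$; its initial condition is the family of restrictions $y_i|_{[-\tau_i,0)}$; solutions exist and are unique for given initial condition and control. $y_{[t]}$ is the family $y_{[t],i}(s)=y_i(t+s)$, $s\in[-\tau_i,0)$. Let $\Sigma^q=\prod_{i=1}^nL^q((-\tau_i,0),\mathbb{R})$ with the product norm. (D) is $L^q$-approximately controllable in time $T$ if for every $\epsilon>0$ and $\phi,\psi\in\Sigma^q$ there is $u\in L^q([0,T],\mathbb{R}^m)$ such that the solution $y$ with initial condition $\phi$ and control $u$ satisfies $\|y_{[T]}-\psi\|_{\Sigma^q}<\epsilon$; it is $L^q$-exactly controllable in time $T$ if for every $\phi,\psi\in\Sigma^q$ there is $u\in L^q([0,T],\mathbb{R}^m)$ such that $y_{[T]}=\psi$. *)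

theory Defs
  imports "HOL-Analysis.Analysis" "HOL-Probability.Essential_Supremum"
begin

section \<open>\<open>L\<^sup>q\<close> spaces on subsets of the real line, \<open>1 \<le> q \<le> \<infinity>\<close>\<close>

text \<open>
  Functions are total; only their values on \<open>S\<close> matter. Lebesgue (not Borel) measurability is
  used throughout. Elements are representatives, so equality in \<open>L\<^sup>q\<close> is almost-everywhere
  equality and is always written out as such below.
\<close>

definition Lq_norm :: "ennreal \<Rightarrow> real set \<Rightarrow> (real \<Rightarrow> 'a::euclidean_space) \<Rightarrow> ennreal" where
  "Lq_norm q S f =
    (if q = \<infinity> then esssup (lebesgue_on S) (\<lambda>x. ennreal (norm (f x)))
     else let p = enn2real q; I = (\<integral>\<^sup>+ x. ennreal (norm (f x) powr p) \<partial>lebesgue_on S)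
          in if I = \<infinity> then \<infinity> else ennreal (enn2real I powr (1 / p)))"

definition Lq_space :: "ennreal \<Rightarrow> real set \<Rightarrow> (real \<Rightarrow> 'a::euclidean_space) set" where
  "Lq_space q S = {f \<in> borel_measurable (lebesgue_on S). Lq_norm q S f < \<infinity>}"


section \<open>The hyperbolic system\<close>

text \<open>
  The index set \<open>{1, \<dots>, n}\<close> is a finite linearly ordered type \<open>'n\<close>, in which \<open>i\<close> has position
  \<open>card {..i}\<close>; \<open>nt\<close> is the number of positive velocities.
\<close>

type_synonym 'n rvec = "(real, 'n) vec"
type_synonym ('n, 'm) rmat = "((real, 'm) vec, 'n) vec"  \<comment> \<open>'n rows, 'm columns\<close>

definition pos_index :: "nat \<Rightarrow> 'n::{finite,linorder} \<Rightarrow> bool" where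
  "pos_index nt i \<longleftrightarrow> card {..i} \<le> nt"

text \<open>The column vector with upper block \<open>v\<^sup>+\<close> and lower block \<open>w\<^sup>-\<close>.\<close>

definition stack :: "nat \<Rightarrow> 'n::{finite,linorder} rvec \<Rightarrow> 'n rvec \<Rightarrow> 'n rvec" where
  "stack nt v w = (\<chi> i. if pos_index nt i then v $ i else w $ i)"

text \<open>
  The integrals from \<open>x\<close> to \<open>x + h\<close> are oriented: they change sign when \<open>h < 0\<close>.
\<close>

definition H_solution ::
  "nat \<Rightarrow> ('n::{finite,linorder} \<Rightarrow> real \<Rightarrow> real) \<Rightarrow> ('n \<Rightarrow> real \<Rightarrow> real) \<Rightarrow>
   ('n, 'n) rmat \<Rightarrow> ('n, 'm) rmat \<Rightarrow> real \<Rightarrow> (real \<Rightarrow> 'n rvec) \<Rightarrow> (real \<Rightarrow> 'm::finite rvec) \<Rightarrow>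
   (real \<Rightarrow> real \<Rightarrow> 'n rvec) \<Rightarrow> bool" where
  "H_solution nt lam d M B T R0 u R \<longleftrightarrow>
    (\<forall>x\<in>{0..1}. R 0 x = R0 x) \<and>
    (\<forall>t\<in>{0..T}. stack nt (R t 0) (R t 1) = M *v stack nt (R t 1) (R t 0) + B *v u t) \<and>
    (\<forall>i. \<forall>t\<in>{0..T}. \<forall>x\<in>{0..1}. \<forall>h.
       t + (LINT \<xi>=x..x+h|lebesgue. (1 / lam i \<xi>)) \<in> {0..T} \<longrightarrow> x + h \<in> {0..1} \<longrightarrow>
       R (t + (LINT \<xi>=x..x+h|lebesgue. (1 / lam i \<xi>))) (x + h) $ i =
         exp (- (LINT \<xi>=x..x+h|lebesgue. (d i \<xi> / lam i \<xi>))) * R t x $ i)"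

text \<open>
  Solutions for \<open>L\<^sup>q\<close> data, which are only given up to null sets. Passing to representatives is
  necessary: at \<open>t = 0\<close> the pointwise boundary condition constrains \<open>R0 0\<close>, \<open>R0 1\<close> and \<open>u 0\<close>, so
  that arbitrary representatives of the data need not admit a pointwise solution.
\<close>

definition H_Lq_solution ::
  "nat \<Rightarrow> ('n::{finite,linorder} \<Rightarrow> real \<Rightarrow> real) \<Rightarrow> ('n \<Rightarrow> real \<Rightarrow> real) \<Rightarrow>
   ('n, 'n) rmat \<Rightarrow> ('n, 'm) rmat \<Rightarrow> real \<Rightarrow> (real \<Rightarrow> 'n rvec) \<Rightarrow> (real \<Rightarrow> 'm::finite rvec) \<Rightarrow>
   (real \<Rightarrow> real \<Rightarrow> 'n rvec) \<Rightarrow> bool" where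
  "H_Lq_solution nt lam d M B T R0 u R \<longleftrightarrow>
    (\<exists>R0' u'. (AE x in lebesgue_on {0..1}. R0' x = R0 x) \<and>
              (AE t in lebesgue_on {0..T}. u' t = u t) \<and>
              H_solution nt lam d M B T R0' u' R)"

definition H_approx_controllable ::
  "ennreal \<Rightarrow> nat \<Rightarrow> ('n::{finite,linorder} \<Rightarrow> real \<Rightarrow> real) \<Rightarrow> ('n \<Rightarrow> real \<Rightarrow> real) \<Rightarrow>
   ('n, 'n) rmat \<Rightarrow> ('n, 'm::finite) rmat \<Rightarrow> real \<Rightarrow> bool" where
  "H_approx_controllable q nt lam d M B T \<longleftrightarrow>
    (\<forall>\<epsilon>::real. \<epsilon> > 0 \<longrightarrow> (\<forall>\<phi> \<in> Lq_space q {0..1}. \<forall>\<psi> \<in> Lq_space q {0..1}.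
       \<exists>u \<in> Lq_space q {0..T}. \<exists>R. H_Lq_solution nt lam d M B T \<phi> u R \<and>
         Lq_norm q {0..1} (\<lambda>x. R T x - \<psi> x) < ennreal \<epsilon>))"

definition H_exact_controllable ::
  "ennreal \<Rightarrow> nat \<Rightarrow> ('n::{finite,linorder} \<Rightarrow> real \<Rightarrow> real) \<Rightarrow> ('n \<Rightarrow> real \<Rightarrow> real) \<Rightarrow>
   ('n, 'n) rmat \<Rightarrow> ('n, 'm::finite) rmat \<Rightarrow> real \<Rightarrow> bool" where
  "H_exact_controllable q nt lam d M B T \<longleftrightarrow>
    (\<forall>\<phi> \<in> Lq_space q {0..1}. \<forall>\<psi> \<in> Lq_space q {0..1}.
       \<exists>u \<in> Lq_space q {0..T}. \<exists>R. H_Lq_solution nt lam d M B T \<phi> u R \<and>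
         (AE x in lebesgue_on {0..1}. R T x = \<psi> x))"


section \<open>The difference equation\<close>

definition diag_matrix :: "('n::finite \<Rightarrow> real) \<Rightarrow> ('n, 'n) rmat" where
  "diag_matrix a = (\<chi> i j. if i = j then a i else 0)"

definition delay :: "('n \<Rightarrow> real \<Rightarrow> real) \<Rightarrow> 'n \<Rightarrow> real" where
  "delay lam i = (LINT x=0..1|lebesgue. (1 / \<bar>lam i x\<bar>))"

definition K_matrix ::
  "('n::finite \<Rightarrow> real \<Rightarrow> real) \<Rightarrow> ('n \<Rightarrow> real \<Rightarrow> real) \<Rightarrow> ('n, 'n) rmat \<Rightarrow> ('n, 'n) rmat" where
  "K_matrix lam d M =
    M ** diag_matrix (\<lambda>i. exp (- (LINT x=0..1|lebesgue. (d i x / \<bar>lam i x\<bar>))))"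

definition D_solution ::
  "('n::finite \<Rightarrow> real) \<Rightarrow> ('n, 'n) rmat \<Rightarrow> ('n, 'm) rmat \<Rightarrow> real \<Rightarrow>
   ('n \<Rightarrow> real \<Rightarrow> real) \<Rightarrow> (real \<Rightarrow> 'm::finite rvec) \<Rightarrow> ('n \<Rightarrow> real \<Rightarrow> real) \<Rightarrow> bool" where
  "D_solution \<tau> K B T \<phi> u y \<longleftrightarrow>
    (\<forall>i. \<forall>s\<in>{-\<tau> i..<0}. y i s = \<phi> i s) \<and>
    (\<forall>t\<in>{0..T}. (\<chi> i. y i t) = K *v (\<chi> i. y i (t - \<tau> i)) + B *v u t)"

definition Sigma_space :: "ennreal \<Rightarrow> ('n::finite \<Rightarrow> real) \<Rightarrow> ('n \<Rightarrow> real \<Rightarrow> real) set" where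
  "Sigma_space q \<tau> = {\<phi>. \<forall>i. \<phi> i \<in> Lq_space q {-\<tau> i<..<0}}"

definition Sigma_norm :: "ennreal \<Rightarrow> ('n::finite \<Rightarrow> real) \<Rightarrow> ('n \<Rightarrow> real \<Rightarrow> real) \<Rightarrow> ennreal" where
  "Sigma_norm q \<tau> \<phi> = (\<Sum>i\<in>UNIV. Lq_norm q {-\<tau> i<..<0} (\<phi> i))"

definition D_approx_controllable ::
  "ennreal \<Rightarrow> ('n::finite \<Rightarrow> real) \<Rightarrow> ('n, 'n) rmat \<Rightarrow> ('n, 'm::finite) rmat \<Rightarrow> real \<Rightarrow> bool" where
  "D_approx_controllable q \<tau> K B T \<longleftrightarrow>
    (\<forall>\<epsilon>::real. \<epsilon> > 0 \<longrightarrow> (\<forall>\<phi> \<in> Sigma_space q \<tau>. \<forall>\<psi> \<in> Sigma_space q \<tau>.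
       \<exists>u \<in> Lq_space q {0..T}. \<exists>y. D_solution \<tau> K B T \<phi> u y \<and>
         Sigma_norm q \<tau> (\<lambda>i s. y i (T + s) - \<psi> i s) < ennreal \<epsilon>))"

definition D_exact_controllable ::
  "ennreal \<Rightarrow> ('n::finite \<Rightarrow> real) \<Rightarrow> ('n, 'n) rmat \<Rightarrow> ('n, 'm::finite) rmat \<Rightarrow> real \<Rightarrow> bool" where
  "D_exact_controllable q \<tau> K B T \<longleftrightarrow>
    (\<forall>\<phi> \<in> Sigma_space q \<tau>. \<forall>\<psi> \<in> Sigma_space q \<tau>.
       \<exists>u \<in> Lq_space q {0..T}. \<exists>y. D_solution \<tau> K B T \<phi> u y \<and>
         (\<forall>i. AE s in lebesgue_on {-\<tau> i<..<0}. y i (T + s) = \<psi> i s))"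

end

theory Submission
  imports Defs
begin

text \<open>
  Let \<open>g\<^sub>i x\<close> be minus the time a signal needs to travel from the inflow end of the \<open>i\<close>-th component
  to \<open>x\<close>, and let \<open>E\<^sub>i x\<close> be the damping exponent accumulated on the way. A function is constant
  along characteristics up to damping iff \<open>R\<^sub>i(t,x) = exp (- E\<^sub>i x) y\<^sub>i(t + g\<^sub>i x)\<close> for some \<open>y\<^sub>i\<close> on
  \<open>[-\<tau>\<^sub>i, T]\<close>, and the boundary condition for \<open>R\<close> is then the difference equation for \<open>y\<close>.
  Because \<open>1/\<lambda>\<^sub>i\<close> and \<open>\<lambda>\<^sub>i\<close> are essentially bounded, \<open>g\<^sub>i\<close> and its inverse distort Lebesgue measure
  by a bounded factor, so \<open>\<phi> \<mapsto> exp (- E\<^sub>i x) \<phi>\<^sub>i(g\<^sub>i x)\<close> is an isomorphism from \<open>\<Sigma>\<^sup>q\<close> onto \<open>L\<^sup>q([0,1])\<close>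
  which matches states of one system with states of the other.
  Solutions of the hyperbolic system only determine the data almost everywhere; this is harmless since
  the difference equation propagates null sets by finitely many translations.
\<close>

section \<open>Maps distorting Lebesgue measure by a bounded factor\<close>

text \<open>The push-forward of Lebesgue measure under \<open>f\<close> is dominated by
  \<open>L\<close> times Lebesgue measure. This is what makes composition with \<open>f\<close> well
  defined on almost-everywhere classes and bounded on L^q. The bound is required on Borel sets only;
  the completed versions are derived below.\<close>

definition measure_bounded :: "real \<Rightarrow> (real \<Rightarrow> real) \<Rightarrow> bool" where
  "measure_bounded L f \<longleftrightarrow> f \<in> borel_measurable borel \<and>
     (\<forall>A\<in>sets borel. emeasure lborel (f -` A) \<le> ennreal L * emeasure lborel A)"

lemma measure_bounded_borel: "measure_bounded L f \<Longrightarrow> f \<in> borel_measurable borel"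
  by (simp add: measure_bounded_def)

lemma measure_bounded_AE_lborel:
  assumes f: "measure_bounded L f" and "AE y in lborel. P y"
  shows "AE x in lborel. P (f x)"
proof -
  obtain N where N: "{y. \<not> P y} \<subseteq> N" "N \<in> sets borel" "emeasure lborel N = 0"
    using assms(2) by (auto elim!: AE_E)
  have "emeasure lborel (f -` N) = 0"
    using f N unfolding measure_bounded_def by (metis le_zero_eq mult_zero_right)
  moreover have "f -` N \<in> sets borel"
    using measurable_sets_borel[OF measure_bounded_borel[OF f]] N(2) by simp
  ultimately show ?thesis using N(1) by (intro AE_I'[of "f -` N"]) (auto simp: null_sets_def)
qed

lemma measure_bounded_AE:
  assumes f: "measure_bounded L f" and "AE y in lebesgue. P y"
  shows "AE x in lebesgue. P (f x)"
  using measure_bounded_AE_lborel[OF f] assms(2) by (simp add: AE_completion_iff)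

text \<open>Borel measurability controls preimages of Borel sets only. A Lebesgue set is a Borel set
  up to a null set, and the distortion bound makes preimages of null sets null.\<close>

lemma measure_bounded_lebesgue:
  assumes f: "measure_bounded L f"
  shows "f \<in> lebesgue \<rightarrow>\<^sub>M lebesgue"
proof (rule completion.measurable_completion2)
  show fl: "f \<in> lebesgue \<rightarrow>\<^sub>M lborel"
    using measure_bounded_borel[OF f] by (simp add: measurable_completion)
  show "null_sets lborel \<subseteq> null_sets (distr lebesgue lborel f)"
  proof
    fix A :: "real set" assume A: "A \<in> null_sets lborel"
    then have Ab: "A \<in> sets borel" by (simp add: null_sets_def)
    then have fA: "f -` A \<in> sets borel"
      using measurable_sets_borel[OF measure_bounded_borel[OF f]] by simp
    have "emeasure lborel (f -` A) \<le> ennreal L * emeasure lborel A"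
      using f Ab by (simp add: measure_bounded_def)
    then have "emeasure lborel (f -` A) = 0"
      using A by (simp add: null_sets_def)
    then show "A \<in> null_sets (distr lebesgue lborel f)"
      using fl Ab fA by (simp add: null_sets_def emeasure_distr)
  qed
qed

text \<open>A Borel representative \<open>h'\<close> of \<open>h\<close> reduces the claim to
  integrating against the push-forward of \<open>lborel\<close>, which is dominated by
  \<open>L\<close> times \<open>lborel\<close>. Changing \<open>h\<close> to \<open>h'\<close> is
  harmless also after composition, because \<open>f\<close> pulls null sets back to null
  sets.\<close>

lemma measure_bounded_nn_integral:
  assumes f: "measure_bounded L f" and h: "h \<in> borel_measurable lebesgue"
  shows "(\<integral>\<^sup>+x. h (f x) \<partial>lebesgue) \<le> ennreal L * (\<integral>\<^sup>+x. h x \<partial>lebesgue)"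
proof -
  obtain h' where h': "h' \<in> borel_measurable lborel" "AE x in lborel. h x = h' x"
    using completion_ex_borel_measurable[OF h] by auto
  have fb[measurable]: "f \<in> borel_measurable borel" using f by (rule measure_bounded_borel)
  have [measurable]: "h' \<in> borel_measurable borel" using h' by simp
  have "(\<integral>\<^sup>+x. h (f x) \<partial>lebesgue) = (\<integral>\<^sup>+x. h' (f x) \<partial>lborel)"
    unfolding nn_integral_completion
    by (rule nn_integral_cong_AE) (use measure_bounded_AE_lborel[OF f h'(2)] in simp)
  also have "\<dots> = (\<integral>\<^sup>+x. h' x \<partial>distr lborel borel f)"
    by (subst nn_integral_distr) auto
  also have "\<dots> \<le> (\<integral>\<^sup>+x. h' x \<partial>scale_measure (ennreal L) lborel)"
  proof (rule nn_integral_mono_measure)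
    show "distr lborel borel f \<le> scale_measure (ennreal L) lborel"
      using f by (subst le_measure) (auto simp: emeasure_distr measure_bounded_def)
  qed simp
  also have "\<dots> = ennreal L * (\<integral>\<^sup>+x. h' x \<partial>lborel)"
    by (rule nn_integral_scale_measure) simp
  also have "(\<integral>\<^sup>+x. h' x \<partial>lborel) = (\<integral>\<^sup>+x. h x \<partial>lebesgue)"
    unfolding nn_integral_completion by (rule nn_integral_cong_AE) (use h' in auto)
  finally show ?thesis .
qed

lemma measure_bounded_compose:
  assumes f: "measure_bounded L f" and g: "measure_bounded L' g" and "L' \<ge> 0"
  shows "measure_bounded (L' * L) (\<lambda>x. f (g x))"
  unfolding measure_bounded_def
proof (intro conjI ballI)
  note [measurable] = measure_bounded_borel[OF f] measure_bounded_borel[OF g]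
  show "(\<lambda>x. f (g x)) \<in> borel_measurable borel" by measurable
  fix A :: "real set" assume A: "A \<in> sets borel"
  then have fA: "f -` A \<in> sets borel"
    using measurable_sets_borel[OF measure_bounded_borel[OF f]] by simp
  have "emeasure lborel ((\<lambda>x. f (g x)) -` A) = emeasure lborel (g -` (f -` A))"
    by (simp add: vimage_def)
  also have "\<dots> \<le> ennreal L' * emeasure lborel (f -` A)"
    using g fA by (simp add: measure_bounded_def)
  also have "\<dots> \<le> ennreal L' * (ennreal L * emeasure lborel A)"
    using f A by (intro mult_left_mono) (auto simp: measure_bounded_def)
  finally show "emeasure lborel ((\<lambda>x. f (g x)) -` A) \<le> ennreal (L' * L) * emeasure lborel A"
    using \<open>L' \<ge> 0\<close> by (simp add: ennreal_mult' mult.assoc)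
qed

lemma measure_bounded_isometry:
  assumes "distr lborel borel f = (lborel :: real measure)" "f \<in> borel_measurable borel"
  shows "measure_bounded 1 f"
  unfolding measure_bounded_def
proof (intro conjI ballI assms)
  fix A :: "real set" assume A: "A \<in> sets borel"
  have "emeasure lborel A = emeasure (distr lborel borel f) A" by (simp add: assms(1))
  also have "\<dots> = emeasure lborel (f -` A)" using A assms(2) by (simp add: emeasure_distr)
  finally show "emeasure lborel (f -` A) \<le> ennreal 1 * emeasure lborel A" by simp
qed

lemma measure_bounded_uminus: "measure_bounded 1 uminus"
  by (rule measure_bounded_isometry) (auto simp: lborel_distr_uminus)

lemma measure_bounded_add: "measure_bounded 1 (\<lambda>x. c + x)"
  using lborel_distr_plus[of c] by (intro measure_bounded_isometry) auto

text \<open>The push-forward of the measure with density \<open>w\<close> under its antiderivative \<open>W\<close> is Lebesgue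
  measure; both distortion bounds are read off from \<open>c \<le> w \<le> C\<close>.\<close>

lemma density_antiderivative_homeo:
  fixes w W :: "real \<Rightarrow> real"
  assumes w: "w \<in> borel_measurable lebesgue" and c: "c > 0"
    and bd: "AE x in lebesgue. c \<le> w x \<and> w x \<le> C"
    and W: "\<And>x y. x \<le> y \<Longrightarrow> (\<integral>\<^sup>+z. ennreal (w z) * indicator {x<..<y} z \<partial>lebesgue) = ennreal (W y - W x)"
    and mono: "\<And>x y. x \<le> y \<Longrightarrow> W x \<le> W y"
  obtains k where "\<And>x. k (W x) = x" "\<And>s. W (k s) = s" "strict_mono W" "strict_mono k"
    "measure_bounded (1 / c) W" "measure_bounded C k"
proof -
  have lower: "c * (y - x) \<le> W y - W x" and upper: "W y - W x \<le> C * (y - x)" if "x \<le> y" for x y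
  proof -
    have "ennreal (c * (y - x)) = (\<integral>\<^sup>+z. ennreal c * indicator {x<..<y} z \<partial>lebesgue)"
      using c that by (subst nn_integral_cmult_indicator) (auto simp: ennreal_mult)
    also have "\<dots> \<le> (\<integral>\<^sup>+z. ennreal (w z) * indicator {x<..<y} z \<partial>lebesgue)"
      by (intro nn_integral_mono_AE) (use bd in eventually_elim, auto split: split_indicator intro: ennreal_leI)
    finally show "c * (y - x) \<le> W y - W x"
      using W[OF that] mono[OF that] by simp
    \<comment> \<open>With \<open>C < c\<close> the almost-everywhere bound would be contradictory,
      although the line is not a null set. Positivity of \<open>C\<close> keeps
      \<open>ennreal C\<close> from being truncated to 0.\<close>
    have "C \<ge> c"
    proof (rule ccontr)
      assume "\<not> c \<le> C"
      then have "AE x::real in lebesgue. False" using bd by (auto elim: eventually_mono)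
      then show False using AE_iff_measurable[of UNIV lebesgue "\<lambda>_::real. False"] by simp
    qed
    then have C: "C > 0" using c by simp
    have "ennreal (W y - W x) \<le> (\<integral>\<^sup>+z. ennreal C * indicator {x<..<y} z \<partial>lebesgue)"
      unfolding W[OF that, symmetric]
      by (intro nn_integral_mono_AE) (use bd in eventually_elim, auto split: split_indicator intro: ennreal_leI)
    also have "\<dots> = ennreal (C * (y - x))"
      using C that by (subst nn_integral_cmult_indicator) (auto simp: ennreal_mult)
    finally show "W y - W x \<le> C * (y - x)" using C that by simp
  qed
  have sm: "strict_mono W"
  proof (rule strict_monoI)
    fix x y :: real assume "x < y"
    then have "0 < c * (y - x)" using c by simp
    with lower[of x y] \<open>x < y\<close> show "W x < W y" by simp
  qed
  have lipW: "\<bar>W x - W y\<bar> \<le> C * \<bar>x - y\<bar>" for x y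
    using upper[of x y] upper[of y x] mono[of x y] mono[of y x] by (cases "x \<le> y") auto
  have Cpos: "C \<ge> 0" using lipW[of 0 1] by simp
  have contW: "continuous_on UNIV W"
    by (rule lipschitz_on_continuous_on[where L=C])
       (auto intro!: lipschitz_onI simp: dist_real_def lipW Cpos)
  have surj: "\<exists>x. W x = s" for s
  proof -
    \<comment> \<open>The radius is chosen so that the linear growth \<open>lower\<close> pushes
      \<open>W\<close> past \<open>s\<close> on both sides; the intermediate value theorem then
      applies on \<open>[-r, r]\<close>.\<close>
    define r where "r = (\<bar>s\<bar> + \<bar>W 0\<bar>) / c"
    have r: "r \<ge> 0" "c * r = \<bar>s\<bar> + \<bar>W 0\<bar>" using c by (simp_all add: r_def)
    have "c * r \<le> W 0 - W (- r)" "c * r \<le> W r - W 0"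
      using lower[of "- r" 0] lower[of 0 r] r(1) by simp_all
    then have "W (- r) \<le> s" "s \<le> W r" using r(2) by linarith+
    then show ?thesis
      using IVT'[of W "- r" s r] r(1) continuous_on_subset[OF contW] by force
  qed
  define k where "k s = (THE x. W x = s)" for s
  have kW: "k (W x) = x" for x
    unfolding k_def by (rule the_equality) (use sm in \<open>auto simp: strict_mono_eq\<close>)
  have Wk: "W (k s) = s" for s using surj[of s] kW by metis
  have smk: "strict_mono k"
    by (rule strict_monoI) (metis Wk sm strict_mono_less)
  have lipk: "\<bar>k s - k t\<bar> \<le> (1 / c) * \<bar>s - t\<bar>" for s t
  proof -
    have "c * \<bar>k s - k t\<bar> \<le> \<bar>s - t\<bar>"
      using lower[of "k s" "k t"] lower[of "k t" "k s"] by (cases "k s \<le> k t") (auto simp: Wk)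
    then show ?thesis using c by (simp add: field_simps)
  qed
  have contk: "continuous_on UNIV k"
    by (rule lipschitz_on_continuous_on[where L="1/c"])
       (use c lipk in \<open>auto intro!: lipschitz_onI simp: dist_real_def\<close>)
  have Wb[measurable]: "W \<in> borel_measurable borel" using contW by (rule borel_measurable_continuous_onI)
  have kb[measurable]: "k \<in> borel_measurable borel" using contk by (rule borel_measurable_continuous_onI)
  have Wl[measurable]: "W \<in> borel_measurable lebesgue"
    using Wb by (simp add: measurable_completion)
  have w': "(\<lambda>x. ennreal (w x)) \<in> borel_measurable lebesgue" using w by measurable
  have vimWb: "W -` A \<in> sets borel" if "A \<in> sets borel" for A
    using measurable_sets_borel[OF Wb that] by simp
  have vimW: "W -` A \<in> sets lebesgue" if "A \<in> sets borel" for A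
    using vimWb[OF that] by simp
  have em: "emeasure (distr (density lebesgue w) borel W) A =
      (\<integral>\<^sup>+z. ennreal (w z) * indicator (W -` A) z \<partial>lebesgue)" if A: "A \<in> sets borel" for A
    using A vimW[OF A] w'
    by (subst emeasure_distr) (auto simp: emeasure_density)
  \<comment> \<open>Lebesgue measure is determined by its values on boxes. The preimage of the
    interval from \<open>l\<close> to \<open>u\<close> is the interval from \<open>k l\<close> to
    \<open>k u\<close>, whose mass under the density is
    \<open>W (k u) - W (k l) = u - l\<close>.\<close>
  have eq: "lborel = distr (density lebesgue w) borel W"
  proof (rule lborel_eqI)
    fix l u :: real assume "\<And>b. b \<in> Basis \<Longrightarrow> l \<bullet> b \<le> u \<bullet> b"
    then have lu: "l \<le> u" by simp
    have "W -` box l u = {k l<..<k u}"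
      using strict_mono_less[OF sm, of "k l"] strict_mono_less[OF sm, of _ "k u"]
      by (auto simp: Wk)
    then have "emeasure (distr (density lebesgue w) borel W) (box l u) = ennreal (u - l)"
      using lu smk by (subst em) (auto simp: W strict_mono_less_eq Wk)
    then show "emeasure (distr (density lebesgue w) borel W) (box l u) = (\<Prod>b\<in>Basis. (u - l) \<bullet> b)"
      by simp
  qed simp
  have ch: "emeasure lborel A = (\<integral>\<^sup>+z. ennreal (w z) * indicator (W -` A) z \<partial>lebesgue)"
    if A: "A \<in> sets borel" for A
    by (subst eq) (rule em[OF A])
  have "measure_bounded (1 / c) W"
    unfolding measure_bounded_def
  proof (intro conjI ballI Wb)
    fix A :: "real set" assume A: "A \<in> sets borel"
    have "ennreal c * emeasure lborel (W -` A) = (\<integral>\<^sup>+z. ennreal c * indicator (W -` A) z \<partial>lebesgue)"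
      using vimW[OF A] vimWb[OF A] by (subst nn_integral_cmult_indicator) (auto)
    also have "\<dots> \<le> emeasure lborel A"
      unfolding ch[OF A]
      by (intro nn_integral_mono_AE) (use bd in eventually_elim, auto split: split_indicator intro: ennreal_leI)
    finally have "ennreal (1 / c) * (ennreal c * emeasure lborel (W -` A)) \<le> ennreal (1 / c) * emeasure lborel A"
      by (intro mult_left_mono) auto
    then show "emeasure lborel (W -` A) \<le> ennreal (1 / c) * emeasure lborel A"
      using c by (simp add: mult.assoc[symmetric] ennreal_mult'[symmetric])
  qed
  moreover have "measure_bounded C k"
    unfolding measure_bounded_def
  proof (intro conjI ballI kb)
    fix A :: "real set" assume A: "A \<in> sets borel"
    have kA: "k -` A \<in> sets borel" using measurable_sets_borel[OF kb A] by simp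
    \<comment> \<open>The change of variables \<open>ch\<close> is applied to the preimage under
      \<open>k\<close>, which \<open>W\<close> pulls back to \<open>A\<close> itself. So the measure
      of that preimage is the integral of \<open>w\<close> over \<open>A\<close>.\<close>
    have WkA: "W -` (k -` A) = A" by (auto simp: kW)
    have "emeasure lborel (k -` A) = (\<integral>\<^sup>+z. ennreal (w z) * indicator A z \<partial>lebesgue)"
      using ch[OF kA] WkA by simp
    also have "\<dots> \<le> (\<integral>\<^sup>+z. ennreal C * indicator A z \<partial>lebesgue)"
      by (intro nn_integral_mono_AE) (use bd in eventually_elim, auto split: split_indicator intro: ennreal_leI)
    also have "\<dots> = ennreal C * emeasure lborel A"
      using A by (subst nn_integral_cmult_indicator) auto
    finally show "emeasure lborel (k -` A) \<le> ennreal C * emeasure lborel A" .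
  qed
  ultimately show thesis using that kW Wk sm smk by blast
qed


section \<open>Comparison of \<open>L\<^sup>q\<close> norms\<close>

lemma AE_lebesgue_on: "S \<in> sets lebesgue \<Longrightarrow> (AE x in lebesgue_on S. P x) \<longleftrightarrow> (AE x in lebesgue. x \<in> S \<longrightarrow> P x)"
  by (simp add: AE_restrict_space_iff)

lemma nn_integral_lebesgue_on:
  "S \<in> sets lebesgue \<Longrightarrow> (\<integral>\<^sup>+x. f x \<partial>lebesgue_on S) = (\<integral>\<^sup>+x. f x * indicator S x \<partial>lebesgue)"
  by (simp add: nn_integral_restrict_space)

lemma borel_measurable_lebesgue_on_iff:
  fixes f :: "real \<Rightarrow> 'a::euclidean_space"
  assumes "S \<in> sets lebesgue"
  shows "f \<in> borel_measurable (lebesgue_on S) \<longleftrightarrow> (\<lambda>x. indicator S x *\<^sub>R f x) \<in> borel_measurable lebesgue"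
  using assms by (simp add: borel_measurable_restrict_space_iff)

text \<open>Lebesgue measure is complete, so a change on a null set preserves measurability.\<close>

lemma borel_measurable_lebesgue_on_AE:
  fixes f :: "real \<Rightarrow> 'a::euclidean_space"
  assumes f: "f \<in> borel_measurable (lebesgue_on S)" and S: "S \<in> sets lebesgue"
    and eq: "AE x in lebesgue_on S. f x = g x"
  shows "g \<in> borel_measurable (lebesgue_on S)"
proof -
  have "AE x in lebesgue. indicator S x *\<^sub>R f x = indicator S x *\<^sub>R g x"
    using eq unfolding AE_lebesgue_on[OF S] by eventually_elim (auto split: split_indicator)
  then show ?thesis
    using f by (auto simp: borel_measurable_lebesgue_on_iff[OF S] intro: borel_measurable_AE)
qed

lemma measure_bounded_AE_lebesgue_on:
  assumes "measure_bounded L f" "AE y in lebesgue_on S'. P y"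
    and "S \<in> sets lebesgue" "S' \<in> sets lebesgue" "f ` S \<subseteq> S'"
  shows "AE x in lebesgue_on S. P (f x)"
proof -
  have "AE x in lebesgue. f x \<in> S' \<longrightarrow> P (f x)"
    using assms by (intro measure_bounded_AE[OF assms(1)]) (simp add: AE_lebesgue_on)
  then show ?thesis
    unfolding AE_lebesgue_on[OF assms(3)] by eventually_elim (use assms(5) in auto)
qed

lemma measure_bounded_measurable_lebesgue_on:
  fixes u :: "real \<Rightarrow> 'a::euclidean_space"
  assumes "measure_bounded L f" "u \<in> borel_measurable (lebesgue_on S')"
    and "S \<in> sets lebesgue" "f ` S \<subseteq> S'"
  shows "(\<lambda>x. u (f x)) \<in> borel_measurable (lebesgue_on S)"
proof -
  have "f \<in> lebesgue_on S \<rightarrow>\<^sub>M lebesgue_on S'"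
    using measure_bounded_lebesgue[OF assms(1)] assms(4)
    by (intro measurable_restrict_space2) (auto intro: measurable_restrict_space1)
  then show ?thesis using assms(2) by (rule measurable_compose)
qed

lemma measure_bounded_nn_integral_on:
  assumes f: "measure_bounded L f" and h: "h \<in> borel_measurable (lebesgue_on S')"
    and S: "S \<in> sets lebesgue" "S' \<in> sets lebesgue" "f ` S \<subseteq> S'"
  shows "(\<integral>\<^sup>+x. h (f x) \<partial>lebesgue_on S) \<le> ennreal L * (\<integral>\<^sup>+x. h x \<partial>lebesgue_on S')"
proof -
  have h': "(\<lambda>x. h x * indicator S' x) \<in> borel_measurable lebesgue"
    using h S(2) by (simp add: borel_measurable_restrict_space_iff_ennreal)
  have "(\<integral>\<^sup>+x. h (f x) * indicator S x \<partial>lebesgue) \<le> (\<integral>\<^sup>+x. h (f x) * indicator S' (f x) \<partial>lebesgue)"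
    using S(3) by (intro nn_integral_mono) (auto split: split_indicator)
  also have "\<dots> \<le> ennreal L * (\<integral>\<^sup>+x. h x * indicator S' x \<partial>lebesgue)"
    by (rule measure_bounded_nn_integral[OF f h'])
  finally show ?thesis by (simp add: nn_integral_lebesgue_on S)
qed

text \<open>A crude substitute for convexity: the sum is at most \<open>card I\<close> times its
  largest term, and the power of that term is one of the summands on the right. It holds for every
  exponent \<open>p \<ge> 0\<close>, so it serves below for both \<open>p\<close> and
  \<open>1 / p\<close>.\<close>

lemma sum_powr_le:
  fixes a :: "'i \<Rightarrow> real"
  assumes "finite I" "\<And>i. i \<in> I \<Longrightarrow> a i \<ge> 0" "p \<ge> 0"
  shows "(\<Sum>i\<in>I. a i) powr p \<le> real (card I) powr p * (\<Sum>i\<in>I. a i powr p)"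
proof (cases "I = {}")
  case False
  define m where "m = Max (a ` I)"
  have "m \<in> a ` I" unfolding m_def using assms(1) False by (intro Max_in) auto
  then obtain j where j: "j \<in> I" "m = a j" by auto
  have le: "a i \<le> m" if "i \<in> I" for i unfolding m_def using assms(1) that by auto
  have "(\<Sum>i\<in>I. a i) powr p \<le> (real (card I) * m) powr p"
    using assms le by (intro powr_mono2 sum_nonneg) (auto intro!: sum_bounded_above)
  also have "\<dots> = real (card I) powr p * m powr p"
    by (rule powr_mult)
  also have "\<dots> \<le> real (card I) powr p * (\<Sum>i\<in>I. a i powr p)"
    unfolding j(2) by (intro mult_left_mono member_le_sum) (use j assms in auto)
  finally show ?thesis .
qed simp

text \<open>The one estimate behind the boundedness of both state maps, with a constant independent
  of \<open>q\<close>. For infinite \<open>q\<close>, composition with \<open>f i\<close> does not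
  increase the norm. For finite exponent \<open>p\<close>, the change of variables costs
  \<open>L powr (1 / p) \<le> L\<close>, and the two uses of \<open>sum_powr_le\<close> cost
  \<open>n * n powr (1 / p) \<le> n * n\<close>. The summand 1 keeps the constant positive for empty
  \<open>I\<close>.\<close>

lemma Lq_norm_dominated:
  fixes f :: "'i \<Rightarrow> real \<Rightarrow> real" and I :: "'i set"
    and v :: "real \<Rightarrow> 'a::euclidean_space" and u :: "'i \<Rightarrow> real \<Rightarrow> 'b::euclidean_space"
  assumes q: "q \<ge> 1" and I: "finite I" and c: "c > 0" and L: "L \<ge> 1"
    and f: "\<And>i. i \<in> I \<Longrightarrow> measure_bounded L (f i)"
    and v: "v \<in> borel_measurable (lebesgue_on S)" and S: "S \<in> sets lebesgue"
    and S': "\<And>i. i \<in> I \<Longrightarrow> S' i \<in> sets lebesgue" "\<And>i. i \<in> I \<Longrightarrow> f i ` S \<subseteq> S' i"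
    and u: "\<And>i. i \<in> I \<Longrightarrow> u i \<in> borel_measurable (lebesgue_on (S' i))"
    and dom: "AE x in lebesgue_on S. norm (v x) \<le> c * (\<Sum>i\<in>I. norm (u i (f i x)))"
  shows "Lq_norm q S v \<le> ennreal (c * (L * (real (card I))\<^sup>2 + 1)) * (\<Sum>i\<in>I. Lq_norm q (S' i) (u i))"
proof -
  define n where "n = real (card I)"
  define C where "C = c * (L * n\<^sup>2 + 1)"
  have "c * (L * n\<^sup>2) \<ge> 0" using c L by simp
  then have C: "c \<le> C" "C > 0" using c unfolding C_def by (simp_all add: distrib_left)
  show ?thesis
  proof (cases "q = \<infinity>")
    case True
    have "AE x in lebesgue_on S. ennreal (norm (u i (f i x))) \<le> Lq_norm q (S' i) (u i)" if "i \<in> I" for i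
      using that S S' True
      by (intro measure_bounded_AE_lebesgue_on[OF f, where S' = "S' i" and P = "\<lambda>y. ennreal (norm (u i y)) \<le> Lq_norm q (S' i) (u i)"])
         (auto simp: Lq_norm_def esssup_AE)
    then have "AE x in lebesgue_on S. \<forall>i\<in>I. ennreal (norm (u i (f i x))) \<le> Lq_norm q (S' i) (u i)"
      using I by (simp add: AE_finite_all)
    with dom have "AE x in lebesgue_on S. ennreal (norm (v x)) \<le> ennreal C * (\<Sum>i\<in>I. Lq_norm q (S' i) (u i))"
    proof eventually_elim
      case (elim x)
      have "ennreal (norm (v x)) \<le> ennreal (c * (\<Sum>i\<in>I. norm (u i (f i x))))"
        using elim(1) by (rule ennreal_leI)
      also have "\<dots> = ennreal c * (\<Sum>i\<in>I. ennreal (norm (u i (f i x))))"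
        using c by (simp add: ennreal_mult' sum_nonneg)
      also have "\<dots> \<le> ennreal C * (\<Sum>i\<in>I. Lq_norm q (S' i) (u i))"
        using elim(2) C by (intro mult_mono sum_mono ennreal_leI) auto
      finally show ?case .
    qed
    then have "Lq_norm q S v \<le> ennreal C * (\<Sum>i\<in>I. Lq_norm q (S' i) (u i))"
      unfolding Lq_norm_def[of q S v] if_P[OF True]
      using v by (intro esssup_I) measurable
    then show ?thesis by (simp add: C_def n_def)
  next
    case False
    define p where "p = enn2real q"
    have p: "p \<ge> 1"
      using q False enn2real_mono[of 1 q] by (auto simp: p_def less_top)
    define J where "J i = (\<integral>\<^sup>+x. ennreal (norm (u i x) powr p) \<partial>lebesgue_on (S' i))" for i
    define Jv where "Jv = (\<integral>\<^sup>+x. ennreal (norm (v x) powr p) \<partial>lebesgue_on S)"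
    have norm_u: "Lq_norm q (S' i) (u i) = (if J i = \<infinity> then \<infinity> else ennreal (enn2real (J i) powr (1 / p)))" for i
      using False by (simp add: Lq_norm_def Let_def J_def p_def)
    have norm_v: "Lq_norm q S v = (if Jv = \<infinity> then \<infinity> else ennreal (enn2real Jv powr (1 / p)))"
      using False by (simp add: Lq_norm_def Let_def Jv_def p_def)
    have "Lq_norm q S v \<le> ennreal C * (\<Sum>i\<in>I. Lq_norm q (S' i) (u i))"
    proof (cases "\<exists>i\<in>I. J i = \<infinity>")
      case True
      then have "(\<Sum>i\<in>I. Lq_norm q (S' i) (u i)) = \<infinity>"
        using I by (auto simp: norm_u)
      \<comment> \<open>Positivity of \<open>C\<close> matters: in \<open>ennreal\<close> the
        product of 0 and infinity is 0.\<close>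
      then show ?thesis using C(2) by (simp add: ennreal_mult_top)
    next
      case fin: False
      define r where "r i = enn2real (J i)" for i
      have r: "J i = ennreal (r i)" if "i \<in> I" for i
        using fin that by (simp add: r_def less_top)
      have r0: "r i \<ge> 0" for i by (simp add: r_def)
      have pw: "norm (v x) powr p \<le> (c * n) powr p * (\<Sum>i\<in>I. norm (u i (f i x)) powr p)"
        if "norm (v x) \<le> c * (\<Sum>i\<in>I. norm (u i (f i x)))" for x
      proof -
        have "norm (v x) powr p \<le> (c * (\<Sum>i\<in>I. norm (u i (f i x)))) powr p"
          using that p by (intro powr_mono2) auto
        also have "\<dots> = c powr p * (\<Sum>i\<in>I. norm (u i (f i x))) powr p"
          by (rule powr_mult)
        also have "\<dots> \<le> c powr p * (n powr p * (\<Sum>i\<in>I. norm (u i (f i x)) powr p))"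
          unfolding n_def using p I by (intro mult_left_mono sum_powr_le) auto
        finally show ?thesis by (simp add: powr_mult mult.assoc)
      qed
      have meas: "(\<lambda>x. ennreal (norm (u i (f i x)) powr p)) \<in> borel_measurable (lebesgue_on S)" if "i \<in> I" for i
        using measure_bounded_measurable_lebesgue_on[OF f u S S'(2)] that by measurable
      have "Jv \<le> (\<integral>\<^sup>+x. ennreal ((c * n) powr p) * (\<Sum>i\<in>I. ennreal (norm (u i (f i x)) powr p)) \<partial>lebesgue_on S)"
        unfolding Jv_def
      proof (rule nn_integral_mono_AE, use dom in eventually_elim)
        case (elim x)
        then show ?case
          using ennreal_leI[OF pw[OF elim]] by (simp add: ennreal_mult' sum_nonneg)
      qed
      also have "\<dots> = ennreal ((c * n) powr p) * (\<Sum>i\<in>I. \<integral>\<^sup>+x. ennreal (norm (u i (f i x)) powr p) \<partial>lebesgue_on S)"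
        using meas by (subst nn_integral_cmult) (auto simp: nn_integral_sum simp del: sum_ennreal)
      also have "\<dots> \<le> ennreal ((c * n) powr p) * (\<Sum>i\<in>I. ennreal L * J i)"
        unfolding J_def
      proof (intro mult_left_mono sum_mono)
        fix i assume i: "i \<in> I"
        then have "(\<lambda>x. ennreal (norm (u i x) powr p)) \<in> borel_measurable (lebesgue_on (S' i))"
          using u by measurable
        from measure_bounded_nn_integral_on[OF f[OF i] this S S'(1)[OF i] S'(2)[OF i]]
        show "(\<integral>\<^sup>+x. ennreal (norm (u i (f i x)) powr p) \<partial>lebesgue_on S)
          \<le> ennreal L * (\<integral>\<^sup>+x. ennreal (norm (u i x) powr p) \<partial>lebesgue_on (S' i))" .
      qed simp
      also have "\<dots> = ennreal ((c * n) powr p * L * (\<Sum>i\<in>I. r i))"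
        using L r r0 by (simp add: sum_distrib_left[symmetric] ennreal_mult' sum_nonneg mult.assoc)
      finally have Jv: "Jv \<le> ennreal ((c * n) powr p * L * (\<Sum>i\<in>I. r i))" .
      then have Jv_fin: "Jv \<noteq> \<infinity>" by (auto simp: top_unique)
      have "enn2real Jv \<le> (c * n) powr p * L * (\<Sum>i\<in>I. r i)"
        using Jv L r0 by (intro enn2real_leI) (auto intro!: mult_nonneg_nonneg sum_nonneg)
      then have "enn2real Jv powr (1 / p) \<le> ((c * n) powr p * L * (\<Sum>i\<in>I. r i)) powr (1 / p)"
        using p by (intro powr_mono2) auto
      also have "\<dots> = c * n * L powr (1 / p) * (\<Sum>i\<in>I. r i) powr (1 / p)"
        using p c by (simp add: powr_mult powr_powr n_def)
      also have "\<dots> \<le> c * n * L powr (1 / p) * (n powr (1 / p) * (\<Sum>i\<in>I. r i powr (1 / p)))"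
        unfolding n_def using p I r0 c by (intro mult_left_mono sum_powr_le) auto
      also have "\<dots> \<le> c * n * L * (n * (\<Sum>i\<in>I. r i powr (1 / p)))"
      proof -
        \<comment> \<open>Taking a root does not increase a number that is at least 1, nor 0. This
          covers both \<open>L\<close> and the cardinality \<open>n\<close>, and removes the
          dependence on \<open>p\<close>.\<close>
        have le: "z powr (1 / p) \<le> z" if "z = 0 \<or> z \<ge> 1" for z :: real
          using that p powr_mono[of "1 / p" 1 z] by auto
        have "n = 0 \<or> n \<ge> 1" by (auto simp: n_def)
        then show ?thesis
          using le[of n] le[of L] L c
          by (intro mult_mono mult_left_mono) (auto simp: n_def intro!: mult_nonneg_nonneg sum_nonneg)
      qed
      also have "\<dots> \<le> C * (\<Sum>i\<in>I. r i powr (1 / p))"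
        using c by (simp add: C_def algebra_simps power2_eq_square sum_nonneg)
      finally have "ennreal (enn2real Jv powr (1 / p)) \<le> ennreal C * (\<Sum>i\<in>I. ennreal (r i powr (1 / p)))"
        using C(2) by (simp add: ennreal_mult'[symmetric] ennreal_leI)
      also have "(\<Sum>i\<in>I. ennreal (r i powr (1 / p))) = (\<Sum>i\<in>I. Lq_norm q (S' i) (u i))"
        using fin by (intro sum.cong) (auto simp: norm_u r_def)
      finally show ?thesis using Jv_fin by (simp add: norm_v)
    qed
    then show ?thesis by (simp add: C_def n_def)
  qed
qed

section \<open>Invariance under null sets and addition of end points\<close>

lemma Lq_norm_AE_cong:
  assumes "f \<in> borel_measurable (lebesgue_on S)" "g \<in> borel_measurable (lebesgue_on S)"
    and "AE x in lebesgue_on S. f x = g x"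
  shows "Lq_norm q S f = Lq_norm q S g"
proof -
  have "esssup (lebesgue_on S) (\<lambda>x. ennreal (norm (f x))) = esssup (lebesgue_on S) (\<lambda>x. ennreal (norm (g x)))"
    using assms by (intro esssup_AE_cong) (measurable, auto elim: eventually_mono)
  moreover have "(\<integral>\<^sup>+x. ennreal (norm (f x) powr p) \<partial>lebesgue_on S) = (\<integral>\<^sup>+x. ennreal (norm (g x) powr p) \<partial>lebesgue_on S)" for p
    using assms(3) by (intro nn_integral_cong_AE) (auto elim: eventually_mono)
  ultimately show ?thesis by (simp add: Lq_norm_def)
qed

lemma Lq_space_AE_cong:
  assumes "f \<in> Lq_space q S" "S \<in> sets lebesgue" "AE x in lebesgue_on S. f x = g x"
  shows "g \<in> Lq_space q S"
  using borel_measurable_lebesgue_on_AE[of f S g] Lq_norm_AE_cong[of f S g q] assms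
  by (auto simp: Lq_space_def)

lemma AE_lebesgue_neq: "AE x in lebesgue. x \<noteq> (a::real)"
  by (simp add: AE_completion_iff AE_lborel_singleton)

lemma AE_lebesgue_on_Icc_Ioo:
  "(AE x in lebesgue_on {a..b::real}. P x) \<longleftrightarrow> (AE x in lebesgue_on {a<..<b}. P x)"
proof -
  have "AE x in lebesgue. x \<in> {a..b} \<longrightarrow> P x" if "AE x in lebesgue. x \<in> {a<..<b} \<longrightarrow> P x"
    using that AE_lebesgue_neq[of a] AE_lebesgue_neq[of b] by eventually_elim auto
  moreover have "AE x in lebesgue. x \<in> {a<..<b} \<longrightarrow> P x" if "AE x in lebesgue. x \<in> {a..b} \<longrightarrow> P x"
    using that by eventually_elim auto
  ultimately have "(AE x in lebesgue. x \<in> {a..b} \<longrightarrow> P x) \<longleftrightarrow> (AE x in lebesgue. x \<in> {a<..<b} \<longrightarrow> P x)"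
    by blast
  then show ?thesis by (simp add: AE_lebesgue_on)
qed

lemma borel_measurable_lebesgue_on_Icc_Ioo:
  fixes f :: "real \<Rightarrow> 'a::euclidean_space"
  shows "f \<in> borel_measurable (lebesgue_on {a..b}) \<longleftrightarrow> f \<in> borel_measurable (lebesgue_on {a<..<b})"
proof -
  have *: "AE x in lebesgue. indicat_real {a..b} x *\<^sub>R f x = indicat_real {a<..<b} x *\<^sub>R f x"
    using AE_lebesgue_neq[of a] AE_lebesgue_neq[of b]
    by eventually_elim (auto split: split_indicator)
  then have "AE x in lebesgue. indicat_real {a<..<b} x *\<^sub>R f x = indicat_real {a..b} x *\<^sub>R f x"
    by eventually_elim (erule sym)
  with * show ?thesis
    by (auto simp: borel_measurable_lebesgue_on_iff intro: borel_measurable_AE)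
qed

lemma Lq_norm_Icc_Ioo:
  fixes f :: "real \<Rightarrow> 'a::euclidean_space"
  assumes f: "f \<in> borel_measurable (lebesgue_on {a<..<b})"
  shows "Lq_norm q {a..b} f = Lq_norm q {a<..<b} f"
proof -
  have "(\<integral>\<^sup>+x. h x * indicator {a..b} x \<partial>lebesgue) = (\<integral>\<^sup>+x. h x * indicator {a<..<b} x \<partial>lebesgue)" for h
    using AE_lebesgue_neq[of a] AE_lebesgue_neq[of b]
    by (intro nn_integral_cong_AE, eventually_elim) (auto split: split_indicator)
  moreover have f': "f \<in> borel_measurable (lebesgue_on {a..b})"
    using f by (simp add: borel_measurable_lebesgue_on_Icc_Ioo)
  have "esssup (lebesgue_on {a..b}) (\<lambda>x. ennreal (norm (f x))) = esssup (lebesgue_on {a<..<b}) (\<lambda>x. ennreal (norm (f x)))"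
  proof -
    have "(\<lambda>x. ennreal (norm (f x))) \<in> borel_measurable (lebesgue_on {a..b})"
      "(\<lambda>x. ennreal (norm (f x))) \<in> borel_measurable (lebesgue_on {a<..<b})"
      using f f' by measurable
    then show ?thesis by (simp add: esssup_eq_AE AE_lebesgue_on_Icc_Ioo)
  qed
  ultimately show ?thesis by (simp add: Lq_norm_def nn_integral_lebesgue_on)
qed


section \<open>Solutions of the difference equation\<close>

text \<open>One application of the right-hand side of the difference equation, with
  \<open>\<phi>\<close> prescribed at negative times. Solutions are obtained as iterates of this
  operator instead of by recursion on time. All functions live on the whole line, so each step only
  involves translations and finite linear combinations.\<close>

definition D_step :: "('n::finite \<Rightarrow> real) \<Rightarrow> ('n, 'n) rmat \<Rightarrow> ('n, 'm::finite) rmat \<Rightarrow>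
   ('n \<Rightarrow> real \<Rightarrow> real) \<Rightarrow> (real \<Rightarrow> 'm rvec) \<Rightarrow> ('n \<Rightarrow> real \<Rightarrow> real) \<Rightarrow> 'n \<Rightarrow> real \<Rightarrow> real" where
  "D_step \<tau> K B \<phi> u y i t =
     (if t < 0 then \<phi> i t else (K *v (\<chi> j. y j (t - \<tau> j)) + B *v u t) $ i)"

abbreviation D_iter where
  "D_iter \<tau> K B \<phi> u k \<equiv> (D_step \<tau> K B \<phi> u ^^ k) \<phi>"

lemma min_delay:
  fixes \<tau> :: "'n::finite \<Rightarrow> real"
  assumes "\<And>i. \<tau> i > 0"
  obtains \<delta> where "\<delta> > 0" "\<And>i. \<delta> \<le> \<tau> i"
proof (rule that)
  show "Min (range \<tau>) > 0" using assms by simp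
  show "Min (range \<tau>) \<le> \<tau> i" for i by simp
qed

text \<open>Method of steps: computing a value at a time \<open>t \<ge> 0\<close> reads the unknown
  only at times at least \<open>\<delta>\<close> earlier, so every further iteration fixes another
  stretch of length \<open>\<delta>\<close>. At \<open>k = 0\<close> only negative times are
  concerned, where both iterates are \<open>\<phi>\<close>.\<close>

lemma D_iter_Suc_eq:
  assumes \<delta>: "\<And>i. \<delta> \<le> \<tau> i" and "t < real k * \<delta>"
  shows "D_iter \<tau> K B \<phi> u (Suc k) i t = D_iter \<tau> K B \<phi> u k i t"
  using assms(2)
proof (induction k arbitrary: i t)
  case 0
  then show ?case by (simp add: D_step_def)
next
  case (Suc k)
  have "D_iter \<tau> K B \<phi> u (Suc k) j (t - \<tau> j) = D_iter \<tau> K B \<phi> u k j (t - \<tau> j)" for j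
    using Suc.prems \<delta>[of j] by (intro Suc.IH) (simp add: algebra_simps)
  then have "D_step \<tau> K B \<phi> u (D_iter \<tau> K B \<phi> u (Suc k)) i t = D_step \<tau> K B \<phi> u (D_iter \<tau> K B \<phi> u k) i t"
    unfolding D_step_def[of _ _ _ _ _ _ i t] by simp
  then show ?case by simp
qed

text \<open>With \<open>T < N * \<delta>\<close> the \<open>N\<close>-th iterate has stabilised on
  all times up to \<open>T\<close>, so it is a fixed point of \<open>D_step\<close> there.\<close>

lemma D_solution_exists:
  fixes \<tau> :: "'n::finite \<Rightarrow> real"
  assumes \<tau>: "\<And>i. \<tau> i > 0"
  shows "\<exists>y. D_solution \<tau> K B T \<phi> u y"
proof -
  obtain \<delta> where \<delta>: "\<delta> > 0" "\<And>i. \<delta> \<le> \<tau> i" by (rule min_delay[where \<tau> = \<tau>, OF \<tau>]) blast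
  obtain N where N: "T < real N * \<delta>" using reals_Archimedean3[OF \<delta>(1)] by blast
  define y where "y = D_iter \<tau> K B \<phi> u N"
  have fixpt: "y i t = D_step \<tau> K B \<phi> u y i t" if "t < real N * \<delta>" for i t
    using D_iter_Suc_eq[OF \<delta>(2) that, where K = K and B = B and \<phi> = \<phi> and u = u and i = i] by (simp add: y_def)
  have "real N * \<delta> \<ge> 0" using \<delta>(1) by simp
  then have "D_solution \<tau> K B T \<phi> u y"
    unfolding D_solution_def
  proof (intro conjI allI ballI)
    fix t assume t: "t \<in> {0..T}"
    then have "y i t = (K *v (\<chi> j. y j (t - \<tau> j)) + B *v u t) $ i" for i
      using fixpt[of t i] N by (simp add: D_step_def)
    then show "(\<chi> i. y i t) = K *v (\<chi> i. y i (t - \<tau> i)) + B *v u t"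
      by (simp add: vec_eq_iff)
  qed (use fixpt in \<open>auto simp: D_step_def\<close>)
  then show ?thesis by blast
qed

text \<open>Uniqueness in explicit form: every solution is a fixed number of applications of
  \<open>D_step\<close> to its data. Properties preserved by one step, such as measurability, thus
  pass to solutions. For \<open>t \<ge> 0\<close> the delayed time \<open>t - \<tau> j\<close> stays
  in the domain of the \<open>j\<close>-th component and lies at least \<open>\<delta>\<close>
  earlier, which feeds the induction.\<close>

lemma D_solution_eq_iter:
  assumes y: "D_solution \<tau> K B T \<phi> u y" and \<delta>: "\<And>i. \<delta> \<le> \<tau> i" "\<delta> > 0"
    and "t \<in> {-\<tau> i..T}" "t < real k * \<delta>"
  shows "y i t = D_iter \<tau> K B \<phi> u k i t"
  using assms(4-)
proof (induction k arbitrary: i t)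
  case 0
  then show ?case using y by (simp add: D_solution_def)
next
  case (Suc k)
  show ?case
  proof (cases "t < 0")
    case True
    then show ?thesis using y Suc.prems by (simp add: D_solution_def D_step_def)
  next
    case False
    have "y j (t - \<tau> j) = D_iter \<tau> K B \<phi> u k j (t - \<tau> j)" for j
      using Suc.prems False \<delta>(1)[of j] \<delta>(2) by (intro Suc.IH) (auto simp: algebra_simps)
    moreover have "y i t = (K *v (\<chi> j. y j (t - \<tau> j)) + B *v u t) $ i"
    proof -
      have "(\<chi> i. y i t) = K *v (\<chi> i. y i (t - \<tau> i)) + B *v u t"
        using y False Suc.prems by (simp add: D_solution_def)
      then show ?thesis by (metis vec_lambda_beta)
    qed
    ultimately show ?thesis
      using False unfolding funpow.simps comp_def D_step_def[of _ _ _ _ _ _ i t] by simp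
  qed
qed

section \<open>Measurability and null sets along the iteration\<close>

lemma measurable_D_step:
  assumes "\<And>i. \<phi> i \<in> borel_measurable lebesgue" "\<And>i. y i \<in> borel_measurable lebesgue"
    and "u \<in> borel_measurable lebesgue"
  shows "D_step \<tau> K B \<phi> u y i \<in> borel_measurable lebesgue"
proof -
  have sh: "(\<lambda>t. y j (t - \<tau> j)) \<in> borel_measurable lebesgue" for j
    using measurable_compose[OF measure_bounded_lebesgue[OF measure_bounded_add[of "- \<tau> j"]] assms(2)[of j]]
    by simp
  have un: "(\<lambda>t. u t $ j) \<in> borel_measurable lebesgue" for j
    using assms(3) by (rule borel_measurable_continuous_on[rotated]) (intro continuous_intros)
  have "(\<lambda>t. if t < 0 then \<phi> i t
      else (\<Sum>j\<in>UNIV. K $ i $ j * y j (t - \<tau> j)) + (\<Sum>j\<in>UNIV. B $ i $ j * u t $ j)) \<in> borel_measurable lebesgue"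
    using assms(1) sh un
    by (intro measurable_If borel_measurable_add borel_measurable_sum borel_measurable_times) auto
  moreover have "D_step \<tau> K B \<phi> u y i = (\<lambda>t. if t < 0 then \<phi> i t
      else (\<Sum>j\<in>UNIV. K $ i $ j * y j (t - \<tau> j)) + (\<Sum>j\<in>UNIV. B $ i $ j * u t $ j))"
    by (rule ext) (simp add: D_step_def matrix_vector_mult_def)
  ultimately show ?thesis by simp
qed

lemma measurable_D_iter:
  assumes "\<And>i. \<phi> i \<in> borel_measurable lebesgue" "u \<in> borel_measurable lebesgue"
  shows "D_iter \<tau> K B \<phi> u k i \<in> borel_measurable lebesgue"
proof (induction k arbitrary: i)
  case 0
  then show ?case using assms by simp
next
  case (Suc k)
  show ?case unfolding funpow.simps comp_def by (rule measurable_D_step[OF assms(1) Suc.IH assms(2)])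
qed

lemma AE_D_step:
  assumes "\<And>i. AE t in lebesgue. \<phi> i t = \<phi>' i t" "\<And>i. AE t in lebesgue. y i t = y' i t"
    and "AE t in lebesgue. u t = u' t"
  shows "AE t in lebesgue. D_step \<tau> K B \<phi> u y i t = D_step \<tau> K B \<phi>' u' y' i t"
proof -
  have "AE t in lebesgue. y j (t - \<tau> j) = y' j (t - \<tau> j)" for j
    using measure_bounded_AE[OF measure_bounded_add[of "- \<tau> j"] assms(2)[of j]] by simp
  then have "AE t in lebesgue. \<forall>j. y j (t - \<tau> j) = y' j (t - \<tau> j)"
    by (simp add: AE_all_countable)
  with assms(1)[of i] assms(3) show ?thesis
    by eventually_elim (simp add: D_step_def)
qed

lemma AE_D_iter:
  assumes "\<And>i. AE t in lebesgue. \<phi> i t = \<phi>' i t" "AE t in lebesgue. u t = u' t"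
  shows "AE t in lebesgue. D_iter \<tau> K B \<phi> u k i t = D_iter \<tau> K B \<phi>' u' k i t"
proof (induction k arbitrary: i)
  case 0
  then show ?case using assms by simp
next
  case (Suc k)
  show ?case unfolding funpow.simps comp_def by (rule AE_D_step[OF assms(1) Suc.IH assms(2)])
qed

text \<open>Extending the data by zero turns measurability and almost-everywhere statements on the
  various intervals into statements on the whole line.\<close>

lemma D_solution_zero_extension:
  assumes "D_solution \<tau> K B T \<phi> u y"
  shows "D_solution \<tau> K B T (\<lambda>i t. indicator {-\<tau> i..<0} t *\<^sub>R \<phi> i t) (\<lambda>t. indicator {0..T} t *\<^sub>R u t) y"
  using assms by (simp add: D_solution_def)

text \<open>The number \<open>N\<close> depends only on \<open>T\<close> and the delays. It precedes
  the data in the statement so that two solutions with different data can be compared at the same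
  iterate.\<close>

lemma D_solution_eq_iter_zero_extension:
  assumes \<tau>: "\<And>i. \<tau> i > 0" 
  obtains N where "\<And>\<phi> u y i t. D_solution \<tau> K B T \<phi> u y \<Longrightarrow> t \<in> {-\<tau> i..T} \<Longrightarrow>
    y i t = D_iter \<tau> K B (\<lambda>i t. indicator {-\<tau> i..<0} t *\<^sub>R \<phi> i t) (\<lambda>t. indicator {0..T} t *\<^sub>R u t) N i t"
proof -
  obtain \<delta> where \<delta>: "\<delta> > 0" "\<And>i. \<delta> \<le> \<tau> i" by (rule min_delay[where \<tau> = \<tau>, OF \<tau>]) blast
  obtain N where "T < real N * \<delta>" using reals_Archimedean3[OF \<delta>(1)] by blast
  then show thesis
    by (intro that[of N] D_solution_eq_iter[OF D_solution_zero_extension \<delta>(2,1)]) auto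
qed

lemma AE_indicator_Ico_Ioo:
  "AE t in lebesgue. indicator {a..<b::real} t *\<^sub>R f t = indicator {a<..<b} t *\<^sub>R (f t :: 'a::real_vector)"
  using AE_lebesgue_neq[of a] by eventually_elim (auto split: split_indicator)

text \<open>The final state is a translate of an iterate formed from measurable data on the whole
  line. The left end point of the initial interval, included in the equation but not in the space,
  is a null set.\<close>

lemma D_solution_measurable:
  assumes \<tau>: "\<And>i. \<tau> i > 0" and "T > 0" and y: "D_solution \<tau> K B T \<phi> u y"
    and \<phi>: "\<And>i. \<phi> i \<in> borel_measurable (lebesgue_on {-\<tau> i<..<0})"
    and u: "u \<in> borel_measurable (lebesgue_on {0..T})"
  shows "(\<lambda>s. y i (T + s)) \<in> borel_measurable (lebesgue_on {-\<tau> i<..<0})"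
proof -
  obtain N where N: "\<And>\<phi> u y i t. D_solution \<tau> K B T \<phi> u y \<Longrightarrow> t \<in> {-\<tau> i..T} \<Longrightarrow>
    y i t = D_iter \<tau> K B (\<lambda>i t. indicator {-\<tau> i..<0} t *\<^sub>R \<phi> i t) (\<lambda>t. indicator {0..T} t *\<^sub>R u t) N i t"
    by (rule D_solution_eq_iter_zero_extension[where \<tau> = \<tau>, OF \<tau>]) blast
  let ?Y = "D_iter \<tau> K B (\<lambda>i t. indicator {-\<tau> i..<0} t *\<^sub>R \<phi> i t) (\<lambda>t. indicator {0..T} t *\<^sub>R u t) N i"
  have "(\<lambda>t. indicator {-\<tau> i..<0} t *\<^sub>R \<phi> i t) \<in> borel_measurable lebesgue" for i
    using \<phi>[of i] AE_symmetric[OF AE_indicator_Ico_Ioo[of "-\<tau> i" 0 "\<phi> i"]]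
    by (auto simp: borel_measurable_lebesgue_on_iff intro: borel_measurable_AE)
  then have "?Y \<in> borel_measurable lebesgue"
    using u by (intro measurable_D_iter) (auto simp: borel_measurable_lebesgue_on_iff)
  then have "(\<lambda>s. ?Y (T + s)) \<in> borel_measurable lebesgue"
    using measurable_compose[OF measure_bounded_lebesgue[OF measure_bounded_add[of T]]] by blast
  then have "(\<lambda>s. ?Y (T + s)) \<in> borel_measurable (lebesgue_on {-\<tau> i<..<0})"
    by (rule measurable_restrict_space1)
  moreover have "?Y (T + s) = y i (T + s)" if "s \<in> {-\<tau> i<..<0}" for s
    using N[OF y, of "T + s" i] that \<open>T > 0\<close> by simp
  ultimately show ?thesis
    by (subst measurable_cong[where g = "\<lambda>s. ?Y (T + s)"]) auto
qed

text \<open>Both final states come from the same finite number of steps, and each step carries null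
  sets to null sets by translation. Hence the final state depends only on the almost-everywhere
  classes of initial datum and control.\<close>

lemma D_solution_AE_unique:
  assumes \<tau>: "\<And>i. \<tau> i > 0" and "T > 0"
    and y: "D_solution \<tau> K B T \<phi> u y" "D_solution \<tau> K B T \<phi>' u' y'"
    and \<phi>: "\<And>i. AE s in lebesgue_on {-\<tau> i<..<0}. \<phi> i s = \<phi>' i s"
    and u: "AE t in lebesgue_on {0..T}. u t = u' t"
  shows "AE s in lebesgue_on {-\<tau> i<..<0}. y i (T + s) = y' i (T + s)"
proof -
  obtain N where N: "\<And>\<phi> u y i t. D_solution \<tau> K B T \<phi> u y \<Longrightarrow> t \<in> {-\<tau> i..T} \<Longrightarrow>
    y i t = D_iter \<tau> K B (\<lambda>i t. indicator {-\<tau> i..<0} t *\<^sub>R \<phi> i t) (\<lambda>t. indicator {0..T} t *\<^sub>R u t) N i t"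
    by (rule D_solution_eq_iter_zero_extension[where \<tau> = \<tau>, OF \<tau>]) blast
  let ?Y = "\<lambda>\<phi> u. D_iter \<tau> K B (\<lambda>i t. indicator {-\<tau> i..<0} t *\<^sub>R \<phi> i t) (\<lambda>t. indicator {0..T} t *\<^sub>R u t) N i"
  have "AE t in lebesgue. indicator {-\<tau> i..<0} t *\<^sub>R \<phi> i t = indicator {-\<tau> i..<0} t *\<^sub>R \<phi>' i t" for i
  proof -
    have "AE s in lebesgue. s \<in> {-\<tau> i<..<0} \<longrightarrow> \<phi> i s = \<phi>' i s"
      using \<phi>[of i] by (simp add: AE_lebesgue_on)
    with AE_lebesgue_neq[of "-\<tau> i"] show ?thesis
      by eventually_elim (auto split: split_indicator)
  qed
  moreover have "AE t in lebesgue. indicator {0..T} t *\<^sub>R u t = indicator {0..T} t *\<^sub>R u' t"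
    using u by (auto simp: AE_lebesgue_on elim!: eventually_mono split: split_indicator)
  ultimately have "AE t in lebesgue. ?Y \<phi> u t = ?Y \<phi>' u' t"
    by (rule AE_D_iter)
  from measure_bounded_AE[OF measure_bounded_add[of T] this]
  have "AE s in lebesgue. s \<in> {-\<tau> i<..<0} \<longrightarrow> y i (T + s) = y' i (T + s)"
    by eventually_elim (use N[OF y(1)] N[OF y(2)] \<open>T > 0\<close> in auto)
  then show ?thesis by (simp add: AE_lebesgue_on)
qed


section \<open>Travel times and damping along characteristics\<close>

lemma interval_integral_lebesgue_eq_integral:
  fixes f :: "real \<Rightarrow> real"
  assumes "set_integrable lebesgue {a..b} f" "a \<le> b"
  shows "(LINT z=a..b|lebesgue. f z) = integral {a..b} f"
proof -
  have "set_integrable lebesgue {a<..<b} f"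
    using assms(1) by (rule set_integrable_subset) auto
  then have "(LINT z:{a<..<b}|lebesgue. f z) = integral {a<..<b} f"
    by (rule set_lebesgue_integral_eq_integral(2))
  then show ?thesis
    using assms(2) by (simp add: interval_lebesgue_integral_le_eq integral_open_interval_real)
qed

lemma interval_integral_lebesgue_additive:
  fixes f :: "real \<Rightarrow> real" and a b :: real
  assumes int: "\<And>a b. set_integrable lebesgue {a..b} f"
  shows "(LINT z=a..b|lebesgue. f z) = (LINT z=0..b|lebesgue. f z) - (LINT z=0..a|lebesgue. f z)"
proof -
  have eq: "(LINT z=a..b|lebesgue. f z) = (if a \<le> b then integral {a..b} f else - integral {b..a} f)" for a b :: real
    using interval_integral_lebesgue_eq_integral[OF int]
    by (simp add: interval_lebesgue_integral_gt_eq'[of "ereal b" "ereal a"])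
  \<comment> \<open>For ordered points this is additivity of the integral over adjacent intervals;
    the instances used afterwards run through all six orderings of \<open>0\<close>,
    \<open>a\<close> and \<open>b\<close>.\<close>
  have comb: "integral {a..c} f + integral {c..b} f = integral {a..b} f" if "a \<le> c" "c \<le> b" for a b c
    using that int by (intro Henstock_Kurzweil_Integration.integral_combine set_lebesgue_integral_eq_integral(1)) auto
  show ?thesis
    unfolding zero_ereal_def eq
    using comb[of 0 a b] comb[of a 0 b] comb[of a b 0] comb[of 0 b a] comb[of b 0 a] comb[of b a 0]
    by (auto split: if_splits)
qed

text \<open>The interval integral does not see its end points, so it suffices to compare integrands
  inside the unit interval, in either orientation of the bounds.\<close>

lemma interval_integral_cong_unit:
  assumes "x \<in> {0..1}" "y \<in> {0..1}" "\<And>z. z \<in> {0<..<1} \<Longrightarrow> f z = h z"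
  shows "(LINT z=ereal x..ereal y|lebesgue. f z) = (LINT z=ereal x..ereal y|lebesgue. h z)"
proof (cases "x \<le> y")
  case True
  then show ?thesis using assms by (intro interval_lebesgue_integral_cong) auto
next
  case False
  then have "(LINT z=ereal y..ereal x|lebesgue. f z) = (LINT z=ereal y..ereal x|lebesgue. h z)"
    using assms by (intro interval_lebesgue_integral_cong) auto
  then show ?thesis using False by (simp add: interval_lebesgue_integral_gt_eq'[of "ereal y" "ereal x"])
qed

text \<open>The bound is raised to at least 1 so that it also accommodates the value 1 by which the
  travel-time density is extended outside the unit interval.\<close>

lemma Linfinity_AE_bound:
  assumes "f \<in> Lq_space \<infinity> S"
  obtains C where "C \<ge> 1" "AE x in lebesgue_on S. norm (f x) \<le> C"
proof -
  define e where "e = Lq_norm \<infinity> S f"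
  have e: "e < \<infinity>" "AE x in lebesgue_on S. ennreal (norm (f x)) \<le> e"
    using assms esssup_AE by (auto simp: Lq_space_def Lq_norm_def e_def)
  have "AE x in lebesgue_on S. norm (f x) \<le> max 1 (enn2real e)"
    using e(2)
  proof eventually_elim
    case (elim x)
    have "e = ennreal (enn2real e)" using e(1) by (simp add: less_top)
    with elim have "ennreal (norm (f x)) \<le> ennreal (enn2real e)" by simp
    then show ?case by (simp add: max.coboundedI2)
  qed
  then show thesis by (rule that[rotated]) simp
qed

lemma measure_bounded_mono:
  assumes "measure_bounded L' f" "L' \<le> L"
  shows "measure_bounded L f"
  using assms unfolding measure_bounded_def
  by (meson ennreal_leI mult_right_mono order_trans zero_le)

text \<open>\<open>pos\<close> tells whether \<open>l\<close> is positive, so that the inflow end is \<open>0\<close>. The maps \<open>g\<close> and \<open>k\<close> are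
  bijections of the whole real line, although only \<open>g\<close> on \<open>[0,1]\<close> matters.\<close>

definition travel_coordinate ::
  "bool \<Rightarrow> (real \<Rightarrow> real) \<Rightarrow> real \<Rightarrow> real \<Rightarrow> (real \<Rightarrow> real) \<Rightarrow> (real \<Rightarrow> real) \<Rightarrow> bool" where
  "travel_coordinate pos l \<tau> L g k \<longleftrightarrow> L \<ge> 1 \<and> measure_bounded L g \<and> measure_bounded L k \<and>
    (\<forall>x. k (g x) = x) \<and> (\<forall>s. g (k s) = s) \<and>
    (\<forall>x. g x \<in> {-\<tau>..0} \<longleftrightarrow> x \<in> {0..1}) \<and> (\<forall>x. g x \<in> {-\<tau><..<0} \<longleftrightarrow> x \<in> {0<..<1}) \<and>
    g (if pos then 0 else 1) = 0 \<and> g (if pos then 1 else 0) = - \<tau> \<and>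
    (\<forall>x\<in>{0..1}. \<forall>y\<in>{0..1}. (LINT \<xi>=x..y|lebesgue. (1 / l \<xi>)) = g x - g y)"

text \<open>Damping accumulated from the inflow end. Increments are \<open>E y - E x\<close>,
  whereas those of the coordinate are \<open>g x - g y\<close>, because \<open>g\<close> is minus
  the travel time. The global bound \<open>C\<close> makes \<open>exp (E x)\<close> and
  \<open>exp (- E x)\<close> bounded weights.\<close>

definition damping_exponent ::
  "bool \<Rightarrow> (real \<Rightarrow> real) \<Rightarrow> (real \<Rightarrow> real) \<Rightarrow> real \<Rightarrow> (real \<Rightarrow> real) \<Rightarrow> bool" where
  "damping_exponent pos l d C E \<longleftrightarrow> E \<in> borel_measurable borel \<and> (\<forall>x. \<bar>E x\<bar> \<le> C) \<and>
    E (if pos then 0 else 1) = 0 \<and> E (if pos then 1 else 0) = (LINT x=0..1|lebesgue. (d x / \<bar>l x\<bar>)) \<and>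
    (\<forall>x\<in>{0..1}. \<forall>y\<in>{0..1}. (LINT \<xi>=x..y|lebesgue. (d \<xi> / l \<xi>)) = E y - E x)"

text \<open>Let \<open>W\<close> be the antiderivative of \<open>1 / \<bar>l\<bar>\<close> vanishing
  at 0. A signal of positive velocity enters at 0, so \<open>g = - W\<close>; one of negative
  velocity enters at 1, so \<open>g x = W x - W 1\<close>. The distortion bounds come from those of
  \<open>W\<close> and its inverse, since reflection and translation preserve Lebesgue
  measure.\<close>

lemma travel_coordinate_exists:
  fixes l :: "real \<Rightarrow> real" and pos :: bool
  assumes l: "l \<in> Lq_space \<infinity> {0<..<1}" and il: "(\<lambda>x. 1 / l x) \<in> Lq_space \<infinity> {0<..<1}"
    and sg: "\<And>x. x \<in> {0..1} \<Longrightarrow> if pos then l x > 0 else l x < 0"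
  defines "\<tau> \<equiv> (LINT x=0..1|lebesgue. (1 / \<bar>l x\<bar>))"
  shows "\<exists>L g k. travel_coordinate pos l \<tau> L g k"
proof -
  obtain C1 where C1: "C1 \<ge> 1" "AE x in lebesgue_on {0<..<1}. norm (1 / l x) \<le> C1"
    by (rule Linfinity_AE_bound[OF il])
  obtain C2 where C2: "C2 \<ge> 1" "AE x in lebesgue_on {0<..<1}. norm (l x) \<le> C2"
    by (rule Linfinity_AE_bound[OF l])
  \<comment> \<open>The value 1 outside the open unit interval keeps the density between positive
    constants on the whole line, so that its antiderivative is a bijection of the line.\<close>
  define w where "w z = (if z \<in> {0<..<1} then 1 / \<bar>l z\<bar> else 1)" for z
  have w_bd: "AE z in lebesgue. 1 / C2 \<le> w z \<and> w z \<le> C1"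
  proof -
    have "AE x in lebesgue. x \<in> {0<..<1} \<longrightarrow> norm (1 / l x) \<le> C1"
      "AE x in lebesgue. x \<in> {0<..<1} \<longrightarrow> norm (l x) \<le> C2"
      using C1(2) C2(2) by (simp_all add: AE_lebesgue_on)
    then show ?thesis
    proof eventually_elim
      case (elim x)
      show ?case
      proof (cases "x \<in> {0<..<1}")
        case True
        then have "l x \<noteq> 0" using sg[of x] by (cases pos) auto
        then show ?thesis using elim True C2(1) by (simp add: w_def frac_le)
      qed (use C1(1) C2(1) in \<open>auto simp: w_def\<close>)
    qed
  qed
  have w0: "w z \<ge> 0" for z by (simp add: w_def)
  have w_meas[measurable]: "w \<in> borel_measurable lebesgue"
  proof -
    have "(\<lambda>x. indicator {0<..<1} x *\<^sub>R (1 / l x)) \<in> borel_measurable lebesgue"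
      using il by (simp add: Lq_space_def borel_measurable_lebesgue_on_iff)
    then have "(\<lambda>x. if x \<in> {0<..<1} then \<bar>indicator {0<..<1} x *\<^sub>R (1 / l x)\<bar> else 1) \<in> borel_measurable lebesgue"
      by (intro measurable_If borel_measurable_abs) auto
    also have "(\<lambda>x. if x \<in> {0<..<1} then \<bar>indicator {0<..<1} x *\<^sub>R (1 / l x)\<bar> else 1) = w"
      by (auto simp: w_def fun_eq_iff)
    finally show ?thesis .
  qed
  have w_int: "set_integrable lebesgue {a..b} w" for a b
    unfolding set_integrable_def
  proof (rule Bochner_Integration.integrable_bound)
    show "integrable lebesgue (\<lambda>x. indicator {a..b} x *\<^sub>R C1)"
      by (intro integrable_scaleR_left integrable_real_indicator) (auto simp: emeasure_lborel_Icc_eq)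
    show "AE x in lebesgue. norm (indicat_real {a..b} x *\<^sub>R w x) \<le> norm (indicat_real {a..b} x *\<^sub>R C1)"
      using w_bd
    proof eventually_elim
      case (elim x)
      then show ?case using C1(1) w0[of x] by (auto split: split_indicator)
    qed
    show "(\<lambda>x. indicat_real {a..b} x *\<^sub>R w x) \<in> borel_measurable lebesgue"
      using w_meas by (intro borel_measurable_scaleR borel_measurable_indicator) auto
  qed
  define W where "W x = (LINT z=0..ereal x|lebesgue. w z)" for x
  have W_diff: "(LINT z=ereal x..ereal y|lebesgue. w z) = W y - W x" for x y
    unfolding W_def by (rule interval_integral_lebesgue_additive[OF w_int])
  have W_set: "(LINT z:{x<..<y}|lebesgue. w z) = W y - W x" if "x \<le> y" for x y
    using W_diff[of x y] that by (simp add: interval_lebesgue_integral_le_eq)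
  have W_mono: "W x \<le> W y" if "x \<le> y" for x y
  proof -
    have "0 \<le> (LINT z:{x<..<y}|lebesgue. w z)"
      unfolding set_lebesgue_integral_def using w0 by (intro integral_nonneg_AE) auto
    then show ?thesis using W_set[OF that] by simp
  qed
  have W_nn: "(\<integral>\<^sup>+z. ennreal (w z) * indicator {x<..<y} z \<partial>lebesgue) = ennreal (W y - W x)" if "x \<le> y" for x y
  proof -
    have "set_integrable lebesgue {x<..<y} w"
      using w_int[of x y] by (rule set_integrable_subset) auto
    then have "(\<integral>\<^sup>+z. ennreal (indicator {x<..<y} z *\<^sub>R w z) \<partial>lebesgue) = ennreal (W y - W x)"
      unfolding W_set[OF that, symmetric] set_lebesgue_integral_def set_integrable_def
      using w0 by (intro nn_integral_eq_integral) auto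
    moreover have "(\<integral>\<^sup>+z. ennreal (w z) * indicator {x<..<y} z \<partial>lebesgue)
      = (\<integral>\<^sup>+z. ennreal (indicator {x<..<y} z *\<^sub>R w z) \<partial>lebesgue)"
      by (intro nn_integral_cong) (auto split: split_indicator)
    ultimately show ?thesis by simp
  qed
  obtain k where k: "\<And>x. k (W x) = x" "\<And>s. W (k s) = s" "strict_mono W" "strict_mono k"
    "measure_bounded (1 / (1 / C2)) W" "measure_bounded C1 k"
    using density_antiderivative_homeo[OF w_meas _ w_bd W_nn W_mono] C2(1) by auto
  have W0: "W 0 = 0" using W_diff[of 0 0] unfolding W_def zero_ereal_def by simp
  have \<tau>: "\<tau> = W 1"
    using interval_integral_cong_unit[of 0 1 "\<lambda>x. 1 / \<bar>l x\<bar>" w] W_diff[of 0 1] W0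
    by (simp add: \<tau>_def w_def zero_ereal_def one_ereal_def)
  define L where "L = max C1 C2"
  have mW: "measure_bounded L W" and mk: "measure_bounded L k"
    using k(5,6) by (auto intro: measure_bounded_mono simp: L_def)
  have L1: "L \<ge> 1" using C1(1) by (simp add: L_def)
  then have L0: "L \<ge> 0" by simp
  note Wless = strict_mono_less[OF k(3)] and Wle = strict_mono_less_eq[OF k(3)]
  have W01: "0 \<le> W x \<longleftrightarrow> 0 \<le> x" "0 < W x \<longleftrightarrow> 0 < x" for x
    using Wle[of 0 x] Wless[of 0 x] by (simp_all add: W0)
  show ?thesis
  proof (cases pos)
    case True
    have int: "(LINT \<xi>=x..y|lebesgue. (1 / l \<xi>)) = - W x - - W y" if "x \<in> {0..1}" "y \<in> {0..1}" for x y
    proof -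
      have "1 / l z = w z" if "z \<in> {0<..<1}" for z
        using that sg[of z] True by (simp add: w_def)
      then show ?thesis
        using interval_integral_cong_unit[OF that, of "\<lambda>z. 1 / l z" w] W_diff[of x y] by simp
    qed
    have "measure_bounded L (\<lambda>x. - W x)" "measure_bounded L (\<lambda>s. k (- s))"
      using measure_bounded_compose[OF measure_bounded_uminus mW L0]
        measure_bounded_compose[OF mk measure_bounded_uminus] by simp_all
    then show ?thesis
      using L1 True k(1,2) int
      by (intro exI[of _ "\<lambda>x. - W x"] exI[of _ "\<lambda>s. k (- s)"] exI[of _ L])
         (auto simp: travel_coordinate_def \<tau> W0 W01 Wle Wless)
  next
    case False
    have int: "(LINT \<xi>=x..y|lebesgue. (1 / l \<xi>)) = (- W 1 + W x) - (- W 1 + W y)" if "x \<in> {0..1}" "y \<in> {0..1}" for x y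
    proof -
      have "1 / l z = - w z" if "z \<in> {0<..<1}" for z
        using that sg[of z] False by (simp add: w_def)
      then show ?thesis
        using interval_integral_cong_unit[OF that, of "\<lambda>z. 1 / l z" "\<lambda>z. - w z"] W_diff[of x y]
        by (simp add: interval_lebesgue_integral_uminus)
    qed
    have "measure_bounded L (\<lambda>x. - W 1 + W x)" "measure_bounded L (\<lambda>s. k (W 1 + s))"
      using measure_bounded_compose[OF measure_bounded_add mW L0]
        measure_bounded_compose[OF mk measure_bounded_add] by (simp_all only: mult_1_left mult_1_right zero_le_one)
    then show ?thesis
      using L1 False k(1,2) int
      by (intro exI[of _ "\<lambda>x. - W 1 + W x"] exI[of _ "\<lambda>s. k (W 1 + s)"] exI[of _ L])
         (auto simp: travel_coordinate_def \<tau> W0 W01 Wle Wless)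
  qed
qed

text \<open>The quotient \<open>d / l\<close> is integrable on the unit interval because
  \<open>d\<close> is integrable and \<open>1 / l\<close> is essentially bounded. Its
  antiderivative, normalised to vanish at the inflow end, is continuous.\<close>

lemma damping_exponent_exists:
  fixes l d :: "real \<Rightarrow> real" and pos :: bool
  assumes il: "(\<lambda>x. 1 / l x) \<in> Lq_space \<infinity> {0<..<1}" and d: "d \<in> Lq_space 1 {0<..<1}"
    and sg: "\<And>x. x \<in> {0..1} \<Longrightarrow> if pos then l x > 0 else l x < 0"
  shows "\<exists>C E. damping_exponent pos l d C E"
proof -
  obtain C1 where C1: "C1 \<ge> 1" "AE x in lebesgue_on {0<..<1}. norm (1 / l x) \<le> C1"
    by (rule Linfinity_AE_bound[OF il])
  define v where "v z = indicator {0<..<1} z *\<^sub>R (d z / l z)" for z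
  have d_meas: "(\<lambda>x. indicator {0<..<1} x *\<^sub>R d x) \<in> borel_measurable lebesgue"
    using d by (simp add: Lq_space_def borel_measurable_lebesgue_on_iff)
  have d_int: "integrable lebesgue (\<lambda>x. indicator {0<..<1} x *\<^sub>R d x)"
  proof (rule integrableI_bounded[OF d_meas])
    have "(\<integral>\<^sup>+x. ennreal (norm (d x) powr 1) \<partial>lebesgue_on {0<..<1}) < \<infinity>"
      using d by (auto simp: Lq_space_def Lq_norm_def Let_def less_top split: if_splits)
    also have "(\<integral>\<^sup>+x. ennreal (norm (d x) powr 1) \<partial>lebesgue_on {0<..<1})
      = (\<integral>\<^sup>+x. ennreal (norm (indicat_real {0<..<1} x *\<^sub>R d x)) \<partial>lebesgue)"
      by (subst nn_integral_lebesgue_on) (auto intro!: nn_integral_cong split: split_indicator)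
    finally show "(\<integral>\<^sup>+x. ennreal (norm (indicat_real {0<..<1} x *\<^sub>R d x)) \<partial>lebesgue) < \<infinity>" .
  qed
  have v_int: "integrable lebesgue v"
  proof (rule Bochner_Integration.integrable_bound)
    show "integrable lebesgue (\<lambda>x. C1 *\<^sub>R (indicator {0<..<1} x *\<^sub>R d x))"
      using d_int by (rule integrable_scaleR_right)
    have "(\<lambda>x. indicator {0<..<1} x *\<^sub>R (1 / l x)) \<in> borel_measurable lebesgue"
      using il by (simp add: Lq_space_def borel_measurable_lebesgue_on_iff)
    with d_meas have "(\<lambda>x. (indicator {0<..<1} x *\<^sub>R d x) * (indicator {0<..<1} x *\<^sub>R (1 / l x))) \<in> borel_measurable lebesgue"
      by (rule borel_measurable_times)
    also have "(\<lambda>x. (indicator {0<..<1} x *\<^sub>R d x) * (indicator {0<..<1} x *\<^sub>R (1 / l x))) = v"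
      by (auto simp: v_def fun_eq_iff split: split_indicator)
    finally show "v \<in> borel_measurable lebesgue" .
    have "AE x in lebesgue. x \<in> {0<..<1} \<longrightarrow> norm (1 / l x) \<le> C1"
      using C1(2) by (simp add: AE_lebesgue_on)
    then show "AE x in lebesgue. norm (v x) \<le> norm (C1 *\<^sub>R (indicat_real {0<..<1} x *\<^sub>R d x))"
    proof eventually_elim
      case (elim x)
      show ?case
      proof (cases "x \<in> {0<..<1}")
        case True
        then have "\<bar>1 / l x\<bar> * \<bar>d x\<bar> \<le> C1 * \<bar>d x\<bar>" using elim by (intro mult_right_mono) auto
        then show ?thesis using True C1(1) by (simp add: v_def abs_mult)
      qed (simp add: v_def)
    qed
  qed
  have v_sint: "set_integrable lebesgue {a..b} v" for a b
    unfolding set_integrable_def using v_int by (intro integrable_mult_indicator) auto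
  define Q where "Q x = integral {0..x} v" for x
  have Q: "(LINT z=0..ereal x|lebesgue. v z) = Q x" if "x \<ge> 0" for x
    using interval_integral_lebesgue_eq_integral[OF v_sint that] by (simp add: Q_def zero_ereal_def)
  have int_v: "(LINT z=ereal x..ereal y|lebesgue. v z) = Q y - Q x" if "x \<in> {0..1}" "y \<in> {0..1}" for x y
    using interval_integral_lebesgue_additive[OF v_sint, of x y] that by (simp add: Q)
  have contQ: "continuous_on {0..1} Q"
    unfolding Q_def using set_lebesgue_integral_eq_integral(1)[OF v_sint]
    by (rule indefinite_integral_continuous_1)
  define e where "e = (if pos then 0 else 1 :: real)"
  \<comment> \<open>Clamping the argument to the unit interval extends the antiderivative to a
    bounded continuous function on the line without changing it on \<open>[0,1]\<close>;
    \<open>e\<close> is the inflow end.\<close>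
  define E where "E x = Q (max 0 (min 1 x)) - Q e" for x
  have E: "E x = Q x - Q e" if "x \<in> {0..1}" for x
    using that by (simp add: E_def)
  have "continuous_on UNIV E"
    unfolding E_def
    by (intro continuous_intros continuous_on_compose2[OF contQ]) auto
  then have "E \<in> borel_measurable borel" by (rule borel_measurable_continuous_onI)
  moreover have "\<exists>C. \<forall>x. \<bar>E x\<bar> \<le> C"
  proof -
    have "compact (Q ` {0..1})" using contQ by (rule compact_continuous_image) simp
    then obtain b where b: "\<forall>x\<in>{0..1}. \<bar>Q x\<bar> \<le> b"
      by (auto dest!: compact_imp_bounded simp: bounded_iff)
    have "\<bar>E x\<bar> \<le> b + b" for x
    proof -
      have "\<bar>Q e\<bar> \<le> b" "\<bar>Q (max 0 (min 1 x))\<bar> \<le> b" using b by (auto simp: e_def)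
      then show ?thesis unfolding E_def by linarith
    qed
    then show ?thesis by blast
  qed
  moreover have "(LINT \<xi>=x..y|lebesgue. (d \<xi> / l \<xi>)) = E y - E x" if "x \<in> {0..1}" "y \<in> {0..1}" for x y
  proof -
    have "(LINT \<xi>=x..y|lebesgue. (d \<xi> / l \<xi>)) = (LINT \<xi>=x..y|lebesgue. v \<xi>)"
      by (rule interval_integral_cong_unit[OF that]) (simp add: v_def)
    then show ?thesis using that by (simp add: int_v E)
  qed
  \<comment> \<open>\<open>1 - e\<close> is the outflow end. For negative velocity both the
    orientation of the integral and the sign of \<open>l\<close> are reversed, so the two signs
    cancel.\<close>
  moreover have "E (1 - e) = (LINT x=0..1|lebesgue. (d x / \<bar>l x\<bar>))"
  proof (cases pos)
    case True
    then have "d z / \<bar>l z\<bar> = v z" if "z \<in> {0<..<1}" for z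
      using that sg[of z] by (simp add: v_def)
    then have "(LINT x=0..1|lebesgue. (d x / \<bar>l x\<bar>)) = Q 1 - Q 0"
      using interval_integral_cong_unit[of 0 1 "\<lambda>z. d z / \<bar>l z\<bar>" v] int_v[of 0 1]
      by (simp add: zero_ereal_def one_ereal_def)
    then show ?thesis using True by (simp add: E e_def)
  next
    case False
    then have "d z / \<bar>l z\<bar> = - v z" if "z \<in> {0<..<1}" for z
      using that sg[of z] by (simp add: v_def)
    then have "(LINT x=0..1|lebesgue. (d x / \<bar>l x\<bar>)) = - (Q 1 - Q 0)"
      using interval_integral_cong_unit[of 0 1 "\<lambda>z. d z / \<bar>l z\<bar>" "\<lambda>z. - v z"] int_v[of 0 1]
      by (simp add: zero_ereal_def one_ereal_def interval_lebesgue_integral_uminus)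
    then show ?thesis using False by (simp add: E e_def)
  qed
  ultimately show ?thesis
    unfolding damping_exponent_def
    by (elim exE, intro exI[of _ E] exI conjI) (auto simp: E e_def split: if_splits)
qed


section \<open>Equivalence of the two systems\<close>

lemma scaled_less:
  assumes "a \<le> ennreal c * b" "b < ennreal (\<epsilon> / c)" "c > 0" "\<epsilon> > 0"
  shows "a < ennreal \<epsilon>"
proof -
  have "ennreal c * b < ennreal c * ennreal (\<epsilon> / c)"
    using assms by (intro ennreal_mult_strict_left_mono) auto
  also have "\<dots> = ennreal \<epsilon>" using assms by (simp add: ennreal_mult'[symmetric])
  finally show ?thesis using assms(1) by simp
qed

text \<open>Isolates the comparison of the two systems from the construction of the coordinates. The
  constants \<open>L\<close> and \<open>C\<close> are common to all components, as the norm
  estimates over all components require.\<close>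

locale characteristics =
  fixes nt :: nat
    and lam d :: "'n::{finite,linorder} \<Rightarrow> real \<Rightarrow> real"
    and M :: "('n, 'n) rmat"
    and B :: "('n, 'm::finite) rmat"
    and T :: real
    and q :: ennreal
    and g k E :: "'n \<Rightarrow> real \<Rightarrow> real"
    and L C :: real
  assumes T: "T > 0" and q: "q \<ge> 1"
    and coordinate: "\<And>i. travel_coordinate (pos_index nt i) (lam i) (delay lam i) L (g i) (k i)"
    and exponent: "\<And>i. damping_exponent (pos_index nt i) (lam i) (d i) C (E i)"
begin

lemma
  shows L: "L \<ge> 1" and g_bounded: "measure_bounded L (g i)" and k_bounded: "measure_bounded L (k i)"
    and kg [simp]: "k i (g i x) = x" and gk [simp]: "g i (k i s) = s"
    and g_Icc: "g i x \<in> {-delay lam i..0} \<longleftrightarrow> x \<in> {0..1}"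
    and g_Ioo: "g i x \<in> {-delay lam i<..<0} \<longleftrightarrow> x \<in> {0<..<1}"
    and g_in: "g i (if pos_index nt i then 0 else 1) = 0"
    and g_out: "g i (if pos_index nt i then 1 else 0) = - delay lam i"
  using coordinate[of i] unfolding travel_coordinate_def by blast+

lemma integral_lam:
  "x \<in> {0..1} \<Longrightarrow> y \<in> {0..1} \<Longrightarrow> (LINT \<xi>=ereal x..ereal y|lebesgue. (1 / lam i \<xi>)) = g i x - g i y"
  using coordinate[of i] unfolding travel_coordinate_def by blast

lemma
  shows E_measurable: "E i \<in> borel_measurable borel" and E_bounded: "\<bar>E i x\<bar> \<le> C"
    and E_in: "E i (if pos_index nt i then 0 else 1) = 0"
    and E_out: "E i (if pos_index nt i then 1 else 0) = (LINT x=0..1|lebesgue. (d i x / \<bar>lam i x\<bar>))"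
  using exponent[of i] unfolding damping_exponent_def by blast+

lemma integral_d:
  "x \<in> {0..1} \<Longrightarrow> y \<in> {0..1} \<Longrightarrow> (LINT \<xi>=ereal x..ereal y|lebesgue. (d i \<xi> / lam i \<xi>)) = E i y - E i x"
  using exponent[of i] unfolding damping_exponent_def by blast

section \<open>Delays and the maps between the two state spaces\<close>

abbreviation "\<tau> \<equiv> delay lam"
abbreviation "K \<equiv> K_matrix lam d M"

text \<open>The end points 0 and 1 are sent to 0 and \<open>-\<tau> i\<close> in some order;
  injectivity of \<open>g i\<close> separates them, and \<open>g i 0\<close> lying between
  \<open>-\<tau> i\<close> and 0 gives the sign.\<close>

lemma delay_pos: "\<tau> i > 0"
proof -
  have "\<tau> i \<ge> 0" using g_Icc[of i 0] by auto
  moreover have "g i 0 \<noteq> g i 1" by (metis kg zero_neq_one)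
  ultimately show ?thesis using g_in[of i] g_out[of i] by (auto split: if_splits)
qed

lemma k_Icc: "k i s \<in> {0..1} \<longleftrightarrow> s \<in> {-\<tau> i..0}"
  using g_Icc[of i "k i s"] by simp

lemma k_Ioo: "k i s \<in> {0<..<1} \<longleftrightarrow> s \<in> {-\<tau> i<..<0}"
  using g_Ioo[of i "k i s"] by simp

text \<open>The argument is a function on the line rather than a state on
  \<open>[-\<tau> i, 0)\<close>: at the inflow end the value at 0 enters, which lets the inflow
  trace at time \<open>t\<close> be the current value \<open>y i t\<close>.\<close>

definition toH :: "('n \<Rightarrow> real \<Rightarrow> real) \<Rightarrow> real \<Rightarrow> 'n rvec" where
  "toH \<phi> x = (\<chi> i. exp (- E i x) * \<phi> i (g i x))"

definition toD :: "(real \<Rightarrow> 'n rvec) \<Rightarrow> 'n \<Rightarrow> real \<Rightarrow> real" where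
  "toD R i s = exp (E i (k i s)) * R (k i s) $ i"

text \<open>An identity of functions, not just almost everywhere, since \<open>g i\<close> and
  \<open>k i\<close> are mutually inverse on the whole line.\<close>

lemma toD_toH [simp]: "toD (toH \<phi>) = \<phi>"
  by (simp add: toD_def toH_def fun_eq_iff exp_minus)

lemma toH_toD [simp]: "toH (toD R) = R"
  by (simp add: toD_def toH_def fun_eq_iff exp_minus vec_eq_iff)

lemma toH_diff: "toH (\<lambda>i s. \<phi> i s - \<psi> i s) x = toH \<phi> x - toH \<psi> x"
  by (simp add: toH_def vec_eq_iff right_diff_distrib)

section \<open>Boundary traces and correspondence of pointwise solutions\<close>

lemma toH_nth_in: "toH \<phi> (if pos_index nt i then 0 else 1) $ i = \<phi> i 0"
  by (simp only: toH_def vec_lambda_beta g_in E_in) simp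

lemma stack_in: "stack nt (toH \<phi> 0) (toH \<phi> 1) = (\<chi> i. \<phi> i 0)"
proof -
  have "stack nt (toH \<phi> 0) (toH \<phi> 1) $ i = \<phi> i 0" for i
    using toH_nth_in[of \<phi> i] by (cases "pos_index nt i") (simp_all add: stack_def)
  then show ?thesis by (simp add: vec_eq_iff)
qed

text \<open>At the outflow ends \<open>g i\<close> equals \<open>-\<tau> i\<close>, and the damping
  over the whole interval is exactly the diagonal factor that distinguishes \<open>K\<close> from
  \<open>M\<close>.\<close>

lemma stack_out: "M *v stack nt (toH \<phi> 1) (toH \<phi> 0) = K *v (\<chi> i. \<phi> i (- \<tau> i))"
proof -
  let ?e = "\<lambda>i. exp (- (LINT x=0..1|lebesgue. (d i x / \<bar>lam i x\<bar>)))"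
  have out: "toH \<phi> (if pos_index nt i then 1 else 0) $ i = ?e i * \<phi> i (- \<tau> i)" for i
    by (simp only: toH_def vec_lambda_beta g_out E_out)
  have "stack nt (toH \<phi> 1) (toH \<phi> 0) $ i = ?e i * \<phi> i (- \<tau> i)" for i
    using out[of i] by (cases "pos_index nt i") (simp_all add: stack_def)
  then have "stack nt (toH \<phi> 1) (toH \<phi> 0) = (\<chi> i. ?e i * \<phi> i (- \<tau> i))"
    by (simp add: vec_eq_iff)
  also have "\<dots> = diag_matrix ?e *v (\<chi> i. \<phi> i (- \<tau> i))"
    by (simp add: diag_matrix_def matrix_vector_mult_def vec_eq_iff if_distrib[of "\<lambda>x. x * _"] cong: if_cong)
  finally show ?thesis by (simp add: K_matrix_def matrix_vector_mul_assoc)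
qed

text \<open>Along a characteristic \<open>t + g i x\<close> is constant, so both sides of the
  transport identity evaluate \<open>y i\<close> at the same time and differ only by the weights.
  The boundary condition is the difference equation by \<open>stack_in\<close> and
  \<open>stack_out\<close>.\<close>

lemma H_solution_of_D_solution:
  assumes y: "D_solution \<tau> K B T \<phi> u y"
  shows "H_solution nt lam d M B T (toH y) u (\<lambda>t. toH (\<lambda>i s. y i (t + s)))"
  unfolding H_solution_def
proof (intro conjI ballI allI impI)
  fix t assume t: "t \<in> {0..T}"
  then show "stack nt (toH (\<lambda>i s. y i (t + s)) 0) (toH (\<lambda>i s. y i (t + s)) 1) =
    M *v stack nt (toH (\<lambda>i s. y i (t + s)) 1) (toH (\<lambda>i s. y i (t + s)) 0) + B *v u t"
    using y by (simp add: stack_in stack_out D_solution_def)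
next
  fix i :: 'n and t x h :: real
  let ?t' = "t + (LINT \<xi>=ereal x..ereal x + ereal h|lebesgue. (1 / lam i \<xi>))"
  assume "t \<in> {0..T}" and x: "x \<in> {0..1}" and xh: "x + h \<in> {0..1}"
  show "toH (\<lambda>i s. y i (?t' + s)) (x + h) $ i =
    exp (- (LINT \<xi>=ereal x..ereal x + ereal h|lebesgue. (d i \<xi> / lam i \<xi>))) * toH (\<lambda>i s. y i (t + s)) x $ i"
    using integral_lam[OF x xh, of i] integral_d[OF x xh, of i]
    by (simp add: toH_def mult.assoc[symmetric] exp_add[symmetric])
qed simp

text \<open>The function \<open>y i\<close> is read off at the inflow boundary for nonnegative times
  and from the initial state for negative ones. It serves as its own initial datum; its relation to
  \<open>R0\<close> is the representation at \<open>t = 0\<close>.\<close>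

lemma D_solution_of_H_solution:
  assumes R: "H_solution nt lam d M B T R0 u R"
  obtains y where "D_solution \<tau> K B T y u y"
    "\<And>t x. t \<in> {0..T} \<Longrightarrow> x \<in> {0..1} \<Longrightarrow> R t x = toH (\<lambda>i s. y i (t + s)) x"
proof -
  define e where "e i = (if pos_index nt i then 0 else 1 :: real)" for i :: 'n
  define y where "y i s = (if s \<ge> 0 then R s (e i) $ i else toD (R 0) i s)" for i :: 'n and s :: real
  have e: "e i \<in> {0..1}" "g i (e i) = 0" "E i (e i) = 0" for i
    using g_in[of i] E_in[of i] by (auto simp: e_def)
  have transport: "R (t + (LINT \<xi>=ereal x..ereal x + ereal h|lebesgue. (1 / lam i \<xi>))) (x + h) $ i =
      exp (- (LINT \<xi>=ereal x..ereal x + ereal h|lebesgue. (d i \<xi> / lam i \<xi>))) * R t x $ i"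
    if "t \<in> {0..T}" "x \<in> {0..1}" "x + h \<in> {0..1}"
      "t + (LINT \<xi>=ereal x..ereal x + ereal h|lebesgue. (1 / lam i \<xi>)) \<in> {0..T}" for t x h i
    using R that unfolding H_solution_def by blast
  \<comment> \<open>The transport identity in coordinate form: two points lie on the same
    characteristic exactly when \<open>t + g i x\<close> agrees, and the displacement is
    \<open>h = x' - x\<close>.\<close>
  have char: "R t' x' $ i = exp (- (E i x' - E i x)) * R t x $ i"
    if "t \<in> {0..T}" "t' \<in> {0..T}" "x \<in> {0..1}" "x' \<in> {0..1}" "t' + g i x' = t + g i x" for t t' x x' i
  proof -
    let ?t' = "t + (LINT \<xi>=ereal x..ereal x + ereal (x' - x)|lebesgue. (1 / lam i \<xi>))"
    have t': "?t' = t'"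
      using that integral_lam[of x x' i] by simp
    have "R ?t' (x + (x' - x)) $ i =
      exp (- (LINT \<xi>=ereal x..ereal x + ereal (x' - x)|lebesgue. (d i \<xi> / lam i \<xi>))) * R t x $ i"
      by (intro transport) (use that t' in simp_all)
    then show ?thesis
      using that integral_d[of x x' i] unfolding t' by simp
  qed
  have rep: "R t x = toH (\<lambda>i s. y i (t + s)) x" if t: "t \<in> {0..T}" and x: "x \<in> {0..1}" for t x
  proof -
    \<comment> \<open>The characteristic through \<open>(t, x)\<close> is followed back to the
      inflow boundary if it gets there at a nonnegative time, and otherwise to the point
      \<open>k i (t + g i x)\<close> of the initial line.\<close>
    have "y i (t + g i x) = exp (E i x) * R t x $ i" for i
    proof (cases "t + g i x \<ge> 0")
      case True
      have "t + g i x \<in> {0..T}" using True t g_Icc[of i x] x by auto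
      then show ?thesis
        using char[of t "t + g i x" x "e i" i] t x e True by (simp add: y_def)
    next
      case False
      let ?s = "t + g i x"
      have "?s \<in> {-\<tau> i..0}" using False t g_Icc[of i x] x by auto
      then have "k i ?s \<in> {0..1}" by (simp only: k_Icc)
      then have "R 0 (k i ?s) $ i = exp (- (E i (k i ?s) - E i x)) * R t x $ i"
        using char[of t 0 x "k i ?s" i] t x T by simp
      then show ?thesis
        using False by (simp add: y_def toD_def mult.assoc[symmetric] exp_add[symmetric])
    qed
    then show ?thesis by (simp add: toH_def vec_eq_iff exp_minus)
  qed
  have "D_solution \<tau> K B T y u y"
    unfolding D_solution_def
  proof (intro conjI ballI allI)
    fix t assume t: "t \<in> {0..T}"
    have "stack nt (R t 0) (R t 1) = M *v stack nt (R t 1) (R t 0) + B *v u t"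
      using R t by (simp add: H_solution_def)
    then show "(\<chi> i. y i t) = K *v (\<chi> i. y i (t - \<tau> i)) + B *v u t"
      using rep[OF t, of 0] rep[OF t, of 1] by (simp add: stack_in stack_out)
  qed simp
  from this rep show thesis by (rule that)
qed

section \<open>Null sets, measurability and norms under the state maps\<close>

lemma toH_AE:
  assumes "\<And>i. AE s in lebesgue_on {-\<tau> i<..<0}. \<phi> i s = \<psi> i s"
  shows "AE x in lebesgue_on {0..1}. toH \<phi> x = toH \<psi> x"
proof -
  have "AE x in lebesgue_on {0<..<1}. \<phi> i (g i x) = \<psi> i (g i x)" for i
    using g_Ioo by (intro measure_bounded_AE_lebesgue_on[OF g_bounded assms]) auto
  then have "AE x in lebesgue_on {0<..<1}. \<forall>i. \<phi> i (g i x) = \<psi> i (g i x)"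
    by (simp add: AE_all_countable)
  then show ?thesis
    unfolding AE_lebesgue_on_Icc_Ioo by eventually_elim (simp add: toH_def)
qed

lemma toD_AE:
  assumes "AE x in lebesgue_on {0..1}. R x = S x"
  shows "AE s in lebesgue_on {-\<tau> i<..<0}. toD R i s = toD S i s"
proof -
  have "AE s in lebesgue_on {-\<tau> i<..<0}. R (k i s) = S (k i s)"
    using k_Ioo assms
    by (intro measure_bounded_AE_lebesgue_on[OF k_bounded assms[unfolded AE_lebesgue_on_Icc_Ioo]]) auto
  then show ?thesis by eventually_elim (simp add: toD_def)
qed

lemma E_lebesgue_on: "E i \<in> borel_measurable (lebesgue_on S)"
  using E_measurable by (intro measurable_restrict_space1) (simp add: measurable_completion)

lemma toH_measurable:
  assumes "\<And>i. \<phi> i \<in> borel_measurable (lebesgue_on {-\<tau> i<..<0})"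
  shows "toH \<phi> \<in> borel_measurable (lebesgue_on {0<..<1})"
proof -
  have "(\<lambda>x. \<phi> i (g i x)) \<in> borel_measurable (lebesgue_on {0<..<1})" for i
    using g_Ioo by (intro measure_bounded_measurable_lebesgue_on[OF g_bounded assms]) auto
  then have "(\<lambda>x. toH \<phi> x $ i) \<in> borel_measurable (lebesgue_on {0<..<1})" for i
    using E_lebesgue_on[of i] by (simp add: toH_def)
  then show ?thesis
    by (subst borel_measurable_euclidean_space) (auto simp: Basis_vec_def inner_axis)
qed

lemma toD_measurable:
  assumes "R \<in> borel_measurable (lebesgue_on {0<..<1})"
  shows "toD R i \<in> borel_measurable (lebesgue_on {-\<tau> i<..<0})"
proof -
  have "(\<lambda>s. R (k i s)) \<in> borel_measurable (lebesgue_on {-\<tau> i<..<0})"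
    "(\<lambda>s. E i (k i s)) \<in> borel_measurable (lebesgue_on {-\<tau> i<..<0})"
    using k_Ioo assms E_lebesgue_on
    by (intro measure_bounded_measurable_lebesgue_on[OF k_bounded, where S' = "{0<..<1}"]; auto)+
  moreover from this(1) have "(\<lambda>s. R (k i s) $ i) \<in> borel_measurable (lebesgue_on {-\<tau> i<..<0})"
    by (rule borel_measurable_continuous_on[rotated]) (intro continuous_intros)
  ultimately show ?thesis unfolding toD_def by measurable
qed

lemma exp_E_le: "exp (E i x) \<le> exp C" "exp (- E i x) \<le> exp C"
  using E_bounded[of i x] by auto

text \<open>The weights are at most \<open>exp C\<close>, so \<open>Lq_norm_dominated\<close>
  applies with the coordinates \<open>g\<close>. The constant is produced before
  \<open>\<phi>\<close> is chosen, because it later rescales the tolerance before any solution is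
  known.\<close>

lemma toH_norm:
  obtains c where "c > 0"
    "\<And>\<phi>. (\<And>i. \<phi> i \<in> borel_measurable (lebesgue_on {-\<tau> i<..<0})) \<Longrightarrow>
      Lq_norm q {0..1} (toH \<phi>) \<le> ennreal c * Sigma_norm q \<tau> \<phi>"
proof (rule that)
  let ?c = "exp C * (L * (real CARD('n))\<^sup>2 + 1)"
  show "?c > 0" using L by (intro mult_pos_pos add_nonneg_pos) auto
  fix \<phi> :: "'n \<Rightarrow> real \<Rightarrow> real" assume \<phi>: "\<And>i. \<phi> i \<in> borel_measurable (lebesgue_on {-\<tau> i<..<0})"
  note m = toH_measurable[where \<phi> = \<phi>, OF \<phi>]
  have "norm (toH \<phi> x) \<le> exp C * (\<Sum>i\<in>UNIV. norm (\<phi> i (g i x)))" for x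
  proof -
    have "norm (toH \<phi> x) \<le> (\<Sum>i\<in>UNIV. \<bar>toH \<phi> x $ i\<bar>)" by (rule norm_le_l1_cart)
    also have "\<dots> \<le> (\<Sum>i\<in>UNIV. exp C * norm (\<phi> i (g i x)))"
      using exp_E_le(2) by (intro sum_mono) (auto simp: toH_def abs_mult intro!: mult_right_mono)
    finally show ?thesis by (simp add: sum_distrib_left)
  qed
  then show "Lq_norm q {0..1} (toH \<phi>) \<le> ennreal ?c * Sigma_norm q \<tau> \<phi>"
    unfolding Sigma_norm_def Lq_norm_Icc_Ioo[OF m]
    using \<phi> g_Ioo by (intro Lq_norm_dominated[where f = g, OF q _ _ L g_bounded m]) auto
qed

text \<open>One component involves a single composition, so the domination estimate is used with a
  one-element index set.\<close>

lemma toD_norm_component: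
  fixes R :: "real \<Rightarrow> 'n rvec"
  assumes R: "R \<in> borel_measurable (lebesgue_on {0<..<1})"
  shows "Lq_norm q {-\<tau> i<..<0} (toD R i) \<le> ennreal (exp C * (L + 1)) * Lq_norm q {0..1} R"
proof -
  have le: "norm (toD R i s) \<le> exp C * norm (R (k i s))" for s
    using exp_E_le(1) unfolding toD_def by (auto simp: abs_mult intro!: mult_mono component_le_norm_cart)
  have "k i ` {-\<tau> i<..<0} \<subseteq> {0<..<1}" using k_Ioo by auto
  then show ?thesis
    using Lq_norm_dominated[where I = "{()}" and f = "\<lambda>_. k i" and u = "\<lambda>_. R" and S' = "\<lambda>_. {0<..<1}"
        and v = "toD R i" and S = "{-\<tau> i<..<0}" and c = "exp C", OF q _ _ L] R k_bounded toD_measurable[OF R] le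
    by (simp add: Lq_norm_Icc_Ioo)
qed

lemma toD_norm:
  obtains c where "c > 0"
    "\<And>R. R \<in> borel_measurable (lebesgue_on {0<..<1}) \<Longrightarrow>
      Sigma_norm q \<tau> (toD R) \<le> ennreal c * Lq_norm q {0..1} R"
proof (rule that)
  let ?c = "exp C * (L + 1)"
  have c: "?c > 0" using L by simp
  then show "real CARD('n) * ?c > 0" by simp
  fix R :: "real \<Rightarrow> 'n rvec" assume R: "R \<in> borel_measurable (lebesgue_on {0<..<1})"
  have "Sigma_norm q \<tau> (toD R) \<le> (\<Sum>i\<in>(UNIV :: 'n set). ennreal ?c * Lq_norm q {0..1} R)"
    unfolding Sigma_norm_def by (intro sum_mono toD_norm_component R)
  also have "\<dots> = ennreal (real CARD('n) * ?c) * Lq_norm q {0..1} R"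
    using c by (simp add: ennreal_mult mult.assoc ennreal_of_nat_eq_real_of_nat)
  finally show "Sigma_norm q \<tau> (toD R) \<le> ennreal (real CARD('n) * ?c) * Lq_norm q {0..1} R" .
qed

lemma Sigma_spaceD: "\<phi> \<in> Sigma_space q \<tau> \<Longrightarrow> \<phi> i \<in> borel_measurable (lebesgue_on {-\<tau> i<..<0})"
  by (simp add: Sigma_space_def Lq_space_def)

lemma Lq_spaceD: "R \<in> Lq_space q {0..1} \<Longrightarrow> R \<in> borel_measurable (lebesgue_on {0<..<1})"
  by (simp add: Lq_space_def borel_measurable_lebesgue_on_Icc_Ioo)

lemma toH_Lq_space:
  assumes "\<phi> \<in> Sigma_space q \<tau>"
  shows "toH \<phi> \<in> Lq_space q {0..1}"
proof -
  note m = Sigma_spaceD[OF assms]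
  obtain c where c: "c > 0" "Lq_norm q {0..1} (toH \<phi>) \<le> ennreal c * Sigma_norm q \<tau> \<phi>"
    by (rule toH_norm) (use m in blast)
  have "Sigma_norm q \<tau> \<phi> < \<infinity>"
    using assms by (simp add: Sigma_norm_def Sigma_space_def Lq_space_def)
  then have "Lq_norm q {0..1} (toH \<phi>) < \<infinity>"
    by (intro le_less_trans[OF c(2)]) (simp add: ennreal_mult_less_top)
  then show ?thesis
    using toH_measurable[where \<phi> = \<phi>, OF m] by (simp add: Lq_space_def borel_measurable_lebesgue_on_Icc_Ioo)
qed

lemma toD_Sigma_space:
  assumes "R \<in> Lq_space q {0..1}"
  shows "toD R \<in> Sigma_space q \<tau>"
  unfolding Sigma_space_def
proof (intro CollectI allI)
  fix i
  note m = Lq_spaceD[OF assms]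
  have "Lq_norm q {0..1} R < \<infinity>" using assms by (simp add: Lq_space_def)
  then have "Lq_norm q {-\<tau> i<..<0} (toD R i) < \<infinity>"
    by (intro le_less_trans[OF toD_norm_component[OF m]]) (simp add: ennreal_mult_less_top)
  then show "toD R i \<in> Lq_space q {-\<tau> i<..<0}"
    using toD_measurable[OF m] by (simp add: Lq_space_def)
qed

lemma H_Lq_solution_of_D_solution:
  assumes "D_solution \<tau> K B T (toD \<phi>) u y"
  shows "H_Lq_solution nt lam d M B T \<phi> u (\<lambda>t. toH (\<lambda>i s. y i (t + s)))"
  unfolding H_Lq_solution_def
proof (intro exI conjI)
  \<comment> \<open>The function \<open>toH y\<close> serves as the representative of the initial
    state. It may differ from \<open>\<phi>\<close> only where \<open>g i x = 0\<close>, that is at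
    the inflow ends, where it takes the value \<open>y i 0\<close> dictated by the equation.\<close>
  have "AE s in lebesgue_on {-\<tau> i<..<0}. y i s = toD \<phi> i s" for i
    using assms by (simp add: AE_lebesgue_on D_solution_def)
  then have "AE x in lebesgue_on {0..1}. toH y x = toH (toD \<phi>) x" by (rule toH_AE)
  then show "AE x in lebesgue_on {0..1}. toH y x = \<phi> x" by simp
  show "H_solution nt lam d M B T (toH y) u (\<lambda>t. toH (\<lambda>i s. y i (t + s)))"
    using assms by (rule H_solution_of_D_solution)
qed simp

text \<open>The hyperbolic solution yields a solution \<open>y\<close> whose initial datum agrees
  with \<open>\<phi>\<close> only almost everywhere, while \<open>D_solution\<close> demands it
  pointwise. So the difference equation is solved afresh from \<open>\<phi>\<close> with the same
  representative \<open>u'\<close> of the control, and \<open>D_solution_AE_unique\<close>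
  identifies the final states.\<close>

lemma D_solution_of_H_Lq_solution:
  assumes R: "H_Lq_solution nt lam d M B T (toH \<phi>) u R" and \<phi>: "\<phi> \<in> Sigma_space q \<tau>"
    and u: "u \<in> Lq_space q {0..T}"
  obtains u' y where "u' \<in> Lq_space q {0..T}" "D_solution \<tau> K B T \<phi> u' y"
    "AE x in lebesgue_on {0..1}. toH (\<lambda>i s. y i (T + s)) x = R T x"
proof -
  obtain R0 u' where R0: "AE x in lebesgue_on {0..1}. R0 x = toH \<phi> x"
    and u': "AE t in lebesgue_on {0..T}. u' t = u t" and sol: "H_solution nt lam d M B T R0 u' R"
    using R unfolding H_Lq_solution_def by blast
  obtain y where y: "D_solution \<tau> K B T y u' y"
    and rep: "\<And>t x. t \<in> {0..T} \<Longrightarrow> x \<in> {0..1} \<Longrightarrow> R t x = toH (\<lambda>i s. y i (t + s)) x"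
    by (rule D_solution_of_H_solution[OF sol]) blast
  obtain z where z: "D_solution \<tau> K B T \<phi> u' z"
    using D_solution_exists[where \<tau> = \<tau>, OF delay_pos] by blast
  have "toH y x = R0 x" if "x \<in> {0..1}" for x
    using rep[of 0 x] sol that T by (simp add: H_solution_def)
  then have "AE x in lebesgue_on {0..1}. toH \<phi> x = toH y x"
    using R0 by (auto simp: AE_lebesgue_on elim!: eventually_mono)
  then have "AE s in lebesgue_on {-\<tau> i<..<0}. \<phi> i s = y i s" for i
    using toD_AE[of "toH \<phi>" "toH y" i] by simp
  then have "AE s in lebesgue_on {-\<tau> i<..<0}. z i (T + s) = y i (T + s)" for i
    by (intro D_solution_AE_unique[where \<tau> = \<tau>, OF delay_pos T z y]) auto
  then have "AE x in lebesgue_on {0..1}. toH (\<lambda>i s. z i (T + s)) x = toH (\<lambda>i s. y i (T + s)) x"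
    by (rule toH_AE)
  then have "AE x in lebesgue_on {0..1}. toH (\<lambda>i s. z i (T + s)) x = R T x"
    using rep[of T] T by (auto simp: AE_lebesgue_on elim!: eventually_mono)
  moreover have "u' \<in> Lq_space q {0..T}"
    using u u' by (intro Lq_space_AE_cong[OF u]) (auto elim: eventually_mono)
  ultimately show thesis using z by (intro that)
qed

section \<open>Transfer of controllability\<close>

lemma approx_controllable_iff:
  "H_approx_controllable q nt lam d M B T \<longleftrightarrow> D_approx_controllable q \<tau> K B T"
proof
  assume H: "H_approx_controllable q nt lam d M B T"
  obtain c where c: "c > 0" "\<And>R. R \<in> borel_measurable (lebesgue_on {0<..<1}) \<Longrightarrow>
      Sigma_norm q \<tau> (toD R) \<le> ennreal c * Lq_norm q {0..1} R"
    by (rule toD_norm) blast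
  show "D_approx_controllable q \<tau> K B T"
    unfolding D_approx_controllable_def
  proof (intro allI impI ballI)
    fix \<epsilon> :: real and \<phi> \<psi>
    assume \<epsilon>: "\<epsilon> > 0" and \<phi>: "\<phi> \<in> Sigma_space q \<tau>" and \<psi>: "\<psi> \<in> Sigma_space q \<tau>"
    \<comment> \<open>The tolerance for the hyperbolic system is reduced by the factor that
      \<open>toD\<close> may cost in norm.\<close>
    have "\<epsilon> / c > 0" using \<epsilon> c(1) by simp
    then obtain u R where u: "u \<in> Lq_space q {0..T}"
      and R: "H_Lq_solution nt lam d M B T (toH \<phi>) u R"
        "Lq_norm q {0..1} (\<lambda>x. R T x - toH \<psi> x) < ennreal (\<epsilon> / c)"
      using H toH_Lq_space[OF \<phi>] toH_Lq_space[OF \<psi>] unfolding H_approx_controllable_def by blast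
    obtain u' y where u': "u' \<in> Lq_space q {0..T}" and y: "D_solution \<tau> K B T \<phi> u' y"
      and eq: "AE x in lebesgue_on {0..1}. toH (\<lambda>i s. y i (T + s)) x = R T x"
      by (rule D_solution_of_H_Lq_solution[OF R(1) \<phi> u])
    have m: "(\<lambda>s. y i (T + s) - \<psi> i s) \<in> borel_measurable (lebesgue_on {-\<tau> i<..<0})" for i
      using D_solution_measurable[where \<tau> = \<tau>, OF delay_pos T y Sigma_spaceD[OF \<phi>], of i] u' Sigma_spaceD[OF \<psi>]
      by (auto simp: Lq_space_def)
    \<comment> \<open>\<open>V\<close> is a representative of the error
      \<open>R T - toH \<psi>\<close>, built from the solution of the difference equation, where
      measurability is known; measurability of the error itself is then inherited. Applying
      \<open>toD\<close> to \<open>V\<close> returns exactly the error in the delay state.\<close>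
    define V where "V = toH (\<lambda>i s. y i (T + s) - \<psi> i s)"
    have V: "V \<in> borel_measurable (lebesgue_on {0<..<1})"
      unfolding V_def using m by (rule toH_measurable)
    have eq': "AE x in lebesgue_on {0..1}. V x = R T x - toH \<psi> x"
      using eq by eventually_elim (simp add: V_def toH_diff)
    have V': "V \<in> borel_measurable (lebesgue_on {0..1})"
      using V by (simp add: borel_measurable_lebesgue_on_Icc_Ioo)
    have "Lq_norm q {0..1} V = Lq_norm q {0..1} (\<lambda>x. R T x - toH \<psi> x)"
      using V' eq' by (intro Lq_norm_AE_cong borel_measurable_lebesgue_on_AE[OF V' _ eq']) auto
    then have "Sigma_norm q \<tau> (toD V) < ennreal \<epsilon>"
      using scaled_less[OF c(2)[OF V] _ c(1) \<epsilon>] R(2) by simp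
    then show "\<exists>u\<in>Lq_space q {0..T}. \<exists>y. D_solution \<tau> K B T \<phi> u y \<and>
      Sigma_norm q \<tau> (\<lambda>i s. y i (T + s) - \<psi> i s) < ennreal \<epsilon>"
      using u' y by (auto simp: V_def)
  qed
next
  assume D: "D_approx_controllable q \<tau> K B T"
  obtain c where c: "c > 0"
    "\<And>\<phi>. (\<And>i. \<phi> i \<in> borel_measurable (lebesgue_on {-\<tau> i<..<0})) \<Longrightarrow>
      Lq_norm q {0..1} (toH \<phi>) \<le> ennreal c * Sigma_norm q \<tau> \<phi>"
    by (rule toH_norm) blast
  show "H_approx_controllable q nt lam d M B T"
    unfolding H_approx_controllable_def
  proof (intro allI impI ballI)
    fix \<epsilon> :: real and \<phi> \<psi> :: "real \<Rightarrow> 'n rvec"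
    assume \<epsilon>: "\<epsilon> > 0" and \<phi>: "\<phi> \<in> Lq_space q {0..1}" and \<psi>: "\<psi> \<in> Lq_space q {0..1}"
    have "\<epsilon> / c > 0" using \<epsilon> c(1) by simp
    then obtain u y where u: "u \<in> Lq_space q {0..T}" and y: "D_solution \<tau> K B T (toD \<phi>) u y"
        "Sigma_norm q \<tau> (\<lambda>i s. y i (T + s) - toD \<psi> i s) < ennreal (\<epsilon> / c)"
      using D toD_Sigma_space[OF \<phi>] toD_Sigma_space[OF \<psi>] unfolding D_approx_controllable_def by blast
    have m: "(\<lambda>s. y i (T + s) - toD \<psi> i s) \<in> borel_measurable (lebesgue_on {-\<tau> i<..<0})" for i
      using D_solution_measurable[where \<tau> = \<tau>, OF delay_pos T y(1) toD_measurable[OF Lq_spaceD[OF \<phi>]], of i]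
        u toD_measurable[OF Lq_spaceD[OF \<psi>]] by (auto simp: Lq_space_def)
    have "Lq_norm q {0..1} (toH (\<lambda>i s. y i (T + s) - toD \<psi> i s)) < ennreal \<epsilon>"
      using scaled_less[OF c(2) y(2) c(1) \<epsilon>] m by blast
    then have "Lq_norm q {0..1} (\<lambda>x. toH (\<lambda>i s. y i (T + s)) x - \<psi> x) < ennreal \<epsilon>"
      by (simp add: toH_diff[abs_def])
    then show "\<exists>u\<in>Lq_space q {0..T}. \<exists>R. H_Lq_solution nt lam d M B T \<phi> u R \<and>
      Lq_norm q {0..1} (\<lambda>x. R T x - \<psi> x) < ennreal \<epsilon>"
      using u H_Lq_solution_of_D_solution[OF y(1)] by blast
  qed
qed

text \<open>Exact attainment is equality almost everywhere, which both state maps preserve; no norm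
  comparison enters beyond mapping the data into the right spaces.\<close>

lemma exact_controllable_iff:
  "H_exact_controllable q nt lam d M B T \<longleftrightarrow> D_exact_controllable q \<tau> K B T"
proof
  assume H: "H_exact_controllable q nt lam d M B T"
  show "D_exact_controllable q \<tau> K B T"
    unfolding D_exact_controllable_def
  proof (intro ballI)
    fix \<phi> \<psi> assume \<phi>: "\<phi> \<in> Sigma_space q \<tau>" and \<psi>: "\<psi> \<in> Sigma_space q \<tau>"
    obtain u R where u: "u \<in> Lq_space q {0..T}"
      and R: "H_Lq_solution nt lam d M B T (toH \<phi>) u R" "AE x in lebesgue_on {0..1}. R T x = toH \<psi> x"
      using H toH_Lq_space[OF \<phi>] toH_Lq_space[OF \<psi>] unfolding H_exact_controllable_def by blast
    obtain u' y where u': "u' \<in> Lq_space q {0..T}" and y: "D_solution \<tau> K B T \<phi> u' y"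
      and eq: "AE x in lebesgue_on {0..1}. toH (\<lambda>i s. y i (T + s)) x = R T x"
      by (rule D_solution_of_H_Lq_solution[OF R(1) \<phi> u])
    have "AE x in lebesgue_on {0..1}. toH (\<lambda>i s. y i (T + s)) x = toH \<psi> x"
      using eq R(2) by eventually_elim simp
    from toD_AE[OF this] have "AE s in lebesgue_on {-\<tau> i<..<0}. y i (T + s) = \<psi> i s" for i
      by simp
    then show "\<exists>u\<in>Lq_space q {0..T}. \<exists>y. D_solution \<tau> K B T \<phi> u y \<and>
      (\<forall>i. AE s in lebesgue_on {-\<tau> i<..<0}. y i (T + s) = \<psi> i s)"
      using u' y by blast
  qed
next
  assume D: "D_exact_controllable q \<tau> K B T"
  show "H_exact_controllable q nt lam d M B T"
    unfolding H_exact_controllable_def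
  proof (intro ballI)
    fix \<phi> \<psi> :: "real \<Rightarrow> 'n rvec"
    assume \<phi>: "\<phi> \<in> Lq_space q {0..1}" and \<psi>: "\<psi> \<in> Lq_space q {0..1}"
    obtain u y where u: "u \<in> Lq_space q {0..T}" and y: "D_solution \<tau> K B T (toD \<phi>) u y"
        "\<And>i. AE s in lebesgue_on {-\<tau> i<..<0}. y i (T + s) = toD \<psi> i s"
      using D toD_Sigma_space[OF \<phi>] toD_Sigma_space[OF \<psi>] unfolding D_exact_controllable_def by blast
    have "AE x in lebesgue_on {0..1}. toH (\<lambda>i s. y i (T + s)) x = \<psi> x"
      using toH_AE[where \<psi> = "toD \<psi>", OF y(2)] by simp
    then show "\<exists>u\<in>Lq_space q {0..T}. \<exists>R. H_Lq_solution nt lam d M B T \<phi> u R \<and>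
      (AE x in lebesgue_on {0..1}. R T x = \<psi> x)"
      using u H_Lq_solution_of_D_solution[OF y(1)] by blast
  qed
qed

end

theorem proposition3p19:
  fixes nt :: nat
    and lam d :: "'n::{finite,linorder} \<Rightarrow> real \<Rightarrow> real"
    and M :: "real ^ 'n::{finite,linorder} ^ 'n::{finite,linorder}"
    and B :: "real ^ 'm::finite ^ 'n::{finite,linorder}"
    and T :: real
    and q :: ennreal
  assumes "nt \<le> CARD('n)"
    and "\<And>i x. pos_index nt i \<Longrightarrow> x \<in> {0..1} \<Longrightarrow> lam i x > 0"
    and "\<And>i x. \<not> pos_index nt i \<Longrightarrow> x \<in> {0..1} \<Longrightarrow> lam i x < 0"
    and "\<And>i. lam i \<in> Lq_space \<infinity> {0<..<1}"
    and "\<And>i. (\<lambda>x. 1 / lam i x) \<in> Lq_space \<infinity> {0<..<1}"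
    and "\<And>i. d i \<in> Lq_space 1 {0<..<1}"
    and "T > 0"
    and "q \<ge> 1"
  shows "(H_approx_controllable q nt lam d M B T \<longleftrightarrow>
            D_approx_controllable q (delay lam) (K_matrix lam d M) B T) \<and>
         (H_exact_controllable q nt lam d M B T \<longleftrightarrow>
            D_exact_controllable q (delay lam) (K_matrix lam d M) B T)"
proof -
  have sg: "if pos_index nt i then lam i x > 0 else lam i x < 0" if "x \<in> {0..1}" for i x
    using assms(2,3) that by simp
  have "\<exists>L g k. travel_coordinate (pos_index nt i) (lam i) (delay lam i) L g k" for i
    unfolding delay_def by (rule travel_coordinate_exists[OF assms(4,5) sg])
  then obtain L g k where gk: "\<And>i. travel_coordinate (pos_index nt i) (lam i) (delay lam i) (L i) (g i) (k i)"
    by metis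
  have "\<exists>C E. damping_exponent (pos_index nt i) (lam i) (d i) C E" for i
    by (rule damping_exponent_exists[OF assms(5,6) sg])
  then obtain C E where E: "\<And>i. damping_exponent (pos_index nt i) (lam i) (d i) (C i) (E i)"
    by metis
  \<comment> \<open>The index type is finite, so the constants of the single components have maxima,
    and the bounds remain valid for these larger constants.\<close>
  interpret characteristics nt lam d M B T q g k E "Max (range L)" "Max (range C)"
  proof
    fix i
    have "L i \<le> Max (range L)" "C i \<le> Max (range C)" by simp_all
    then show "travel_coordinate (pos_index nt i) (lam i) (delay lam i) (Max (range L)) (g i) (k i)"
      "damping_exponent (pos_index nt i) (lam i) (d i) (Max (range C)) (E i)"
      using gk[of i] E[of i] measure_bounded_mono[of "L i" _ "Max (range L)"]
      unfolding travel_coordinate_def damping_exponent_def by (meson order_trans)+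
  qed (use assms in auto)
  show ?thesis using approx_controllable_iff exact_controllable_iff by simp
qed

end
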